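(* Let $\theta=2(AB+AC+BC)-(A^2+B^2+C^2)$. Consider the following system of four equations in the unknowns $X,Y,Z,\rho$ with parameters $A,B,C$ (all complex): $$ \begin{aligned} &-2A^2X-2ABC+2ABX+2ABY+2ACX+2ACZ-2AX^2+2AXY+2AXZ-2AYZ\\ &\quad-2B^2Y+2BCY+2BCZ+2BXY-2BXZ-2BY^2+2BYZ-2C^2Z-2CXY+2CXZ+2CYZ-2CZ^2=0,\\ &\rho\big(2(AY+AZ+YZ)-A^2-Y^2-Z^2\big)-AYZ=0,\\ &\rho\big(2(BX+BZ+XZ)-X^2-B^2-Z^2\big)-BXZ=0,\\ &\rho\big(2(CX+CY+XY)-X^2-Y^2-C^2\big)-CXY=0. \end{aligned} $$ The solutions to this system are organized in the following components; that is, there is a complex irreducible subvariety $\mathcal{W}\subset\mathbb{C}^6$ of codimension two and degree six such that every solution belongs to at least one of the following: 1. $\rho=\frac{ABC}{\theta}$ and $(X,Y,Z)=\left(\frac{A(B+C-A)^2}{\theta},\frac{B(A+C-B)^2}{\theta},\frac{C(A+B-C)^2}{\theta}\right)$; 2. $\rho=\frac{ABC}{\theta}$ and $(A,B,C,X,Y,Z)\in\mathcal{W}$; 3. $\rho=0$ or $A=0$ or $B=0$ or $C=0$ or $\theta=0$.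
   Context: The geometric origin: $A,B,C$ are the squared distances $\lVert v_1-v_2\rVert^2,\lVert v_0-v_2\rVert^2,\lVert v_0-v_1\rVert^2$ for three points $v_0,v_1,v_2$ of a plane; $X,Y,Z$ are the squared distances of an unknown point $P$ of the plane to $v_0,v_1,v_2$; $\rho$ is the squared common radius of three circles, each through $P$ and two of the $v_i$. The four equations are the vanishing of the corresponding Cayley–Menger determinants. *)

theory Defs
  imports
    "HOL-Analysis.Analysis"
    "HOL-Library.Extended_Nat"
    "HOL-Library.Function_Algebras"
    "HOL-Computational_Algebra.Polynomial"
begin

definition monomial_fun :: "('n::finite \<Rightarrow> nat) \<Rightarrow> complex ^ 'n \<Rightarrow> complex" where
  "monomial_fun \<alpha> x = (\<Prod>i\<in>UNIV. x $ i ^ \<alpha> i)"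

text \<open>Since the complex numbers are an infinite field, polynomials in the coordinates of
  affine space are identified with the functions they define.\<close>

definition poly_funs_le :: "nat \<Rightarrow> (complex ^ 'n::finite \<Rightarrow> complex) set" where
  "poly_funs_le t = {f. \<exists>c. f = (\<lambda>x. \<Sum>\<alpha>\<in>{\<alpha>. sum \<alpha> UNIV \<le> t}. c \<alpha> * monomial_fun \<alpha> x)}"

definition poly_funs :: "(complex ^ 'n::finite \<Rightarrow> complex) set" where
  "poly_funs = (\<Union>t. poly_funs_le t)"

text \<open>The exponents \<open>\<alpha>\<close> of total degree at most \<open>t\<close> form a finite set, so the sum above is a
  genuine one.\<close>

lemma finite_exponents_le: "finite {\<alpha> :: 'n::finite \<Rightarrow> nat. sum \<alpha> UNIV \<le> t}"
proof (rule finite_subset)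
  show "{\<alpha> :: 'n \<Rightarrow> nat. sum \<alpha> UNIV \<le> t} \<subseteq> PiE UNIV (\<lambda>_. {..t})"
  proof
    fix \<alpha> :: "'n \<Rightarrow> nat" assume a: "\<alpha> \<in> {\<alpha>. sum \<alpha> UNIV \<le> t}"
    have "\<alpha> i \<le> t" for i
      using member_le_sum[of i UNIV \<alpha>] a by simp
    then show "\<alpha> \<in> PiE UNIV (\<lambda>_. {..t})" by auto
  qed
qed (intro finite_PiE; simp)

definition algebraic_set :: "(complex ^ 'n::finite) set \<Rightarrow> bool" where
  "algebraic_set V \<longleftrightarrow> (\<exists>S \<subseteq> poly_funs. V = {x. \<forall>f\<in>S. f x = 0})"

definition irreducible_variety :: "(complex ^ 'n::finite) set \<Rightarrow> bool" where
  "irreducible_variety V \<longleftrightarrow> algebraic_set V \<and> V \<noteq> {} \<and>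
     (\<forall>V1 V2. algebraic_set V1 \<and> algebraic_set V2 \<and> V = V1 \<union> V2 \<longrightarrow> V = V1 \<or> V = V2)"

text \<open>Krull dimension: the supremum of the lengths of strict chains of irreducible closed
  subsets.\<close>

definition variety_dim :: "(complex ^ 'n::finite) set \<Rightarrow> enat" where
  "variety_dim V = Sup {enat k | k. \<exists>Z :: nat \<Rightarrow> (complex ^ 'n) set.
     (\<forall>i\<le>k. irreducible_variety (Z i) \<and> Z i \<subseteq> V) \<and> (\<forall>i<k. Z i \<subset> Z (Suc i))}"

definition variety_codim :: "(complex ^ 'n::finite) set \<Rightarrow> enat" where
  "variety_codim V = enat CARD('n) - variety_dim V"

interpretation fun_vs: vector_space "\<lambda>(c::complex) (f :: 'a \<Rightarrow> complex) x. c * f x"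
  by unfold_locales (auto simp: fun_eq_iff algebra_simps)

text \<open>The affine Hilbert function of \<open>V\<close> is \<open>t \<mapsto> dim (P\<^sub>t / (P\<^sub>t \<inter> I(V)))\<close>, where \<open>P\<^sub>t\<close> consists of the
  polynomials of degree at most \<open>t\<close>; the quotient is the space of restrictions to \<open>V\<close> of
  elements of \<open>P\<^sub>t\<close>. It agrees with the Hilbert function of the projective closure of \<open>V\<close>, so the
  degree below is that of the projective closure.\<close>

definition hilbert_fun :: "(complex ^ 'n::finite) set \<Rightarrow> nat \<Rightarrow> nat" where
  "hilbert_fun V t = fun_vs.dim ((\<lambda>f x. if x \<in> V then f x else 0) ` poly_funs_le t)"

definition hilbert_poly :: "(complex ^ 'n::finite) set \<Rightarrow> real poly" where
  "hilbert_poly V = (THE p. eventually (\<lambda>t. real (hilbert_fun V t) = poly p (real t)) sequentially)"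

definition variety_degree :: "(complex ^ 'n::finite) set \<Rightarrow> real" where
  "variety_degree V = fact (degree (hilbert_poly V)) * lead_coeff (hilbert_poly V)"

definition theta :: "complex \<Rightarrow> complex \<Rightarrow> complex \<Rightarrow> complex" where
  "theta A B C = 2 * (A * B + A * C + B * C) - (A\<^sup>2 + B\<^sup>2 + C\<^sup>2)"

end

theory Submission
  imports Defs
begin

text \<open>The variety is the Zariski closure of the set of squared distances of four concyclic points.
  On a circle of squared radius \<open>- s\<close> whose points are parametrised by \<open>u \<noteq> 0\<close>, the points \<open>u\<close> and
  \<open>v\<close> have squared distance \<open>s * (u - v)\<^sup>2 / (u * v)\<close>; with parameters \<open>x, y, z, 1\<close> and denominators
  cleared this is the polynomial map \<open>concyclic_dist\<close>.  The closure of its image is irreducible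
  because any two points of the image lie on a polynomial curve inside it.

  \<^emph>\<open>The system.\<close>  Put \<open>s = - \<rho>\<close> and write \<open>X, Y, Z\<close> as squared chords from the parameter \<open>1\<close> to
  parameters \<open>x, y, z\<close>, each determined up to inversion.  Each circle equation is quadratic in its
  remaining unknown and forces the third side to be the chord of the quotient or of the product of
  two parameters (\<open>third_chord\<close>).  Inverting \<open>y\<close> and \<open>z\<close> if necessary makes two of the three sides
  quotients.  If the third one is a quotient too, the four points are concyclic.  Otherwise the
  Cayley-Menger polynomial is, up to a nonzero factor, \<open>x + y * z\<close> times powers of \<open>x \<plusminus> 1\<close>, \<open>y \<plusminus> 1\<close>,
  \<open>z \<plusminus> 1\<close>.  A self-inverse parameter again gives the concyclic case, and \<open>x = - (y * z)\<close> gives the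
  orthocentre, as in the theorem of Johnson on three equal circles through a point.

  \<^emph>\<open>The degree.\<close>  The differences of rows of the distance matrix form a \<open>3 \<times> 4\<close> matrix of linear
  forms that has rank at most two on the variety, so four cubics vanish there.  Modulo four suitable
  linear forms \<open>h\<^sub>0, \<dots>, h\<^sub>3\<close> they span all cubics in the two remaining coordinates \<open>X, Y\<close>.  Hence the
  functions on the variety are spanned over the polynomials in the \<open>h\<^sub>k\<close> by the six monomials of
  degree at most two in \<open>X, Y\<close> (\<open>poly_funs_le_subset_std_span\<close>).  There is no further relation: over
  every value of the \<open>h\<^sub>k\<close> near \<open>(1, 0, 0, 0)\<close> the variety has points near the six vertices of a
  complete quadrilateral, and these lie on no conic (\<open>std_mono_independent\<close>).  So the Hilbert
  function at \<open>t \<ge> 2\<close> is \<open>(t+4 choose 4) + 2 (t+3 choose 4) + 3 (t+2 choose 4)\<close>, a polynomial of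
  degree \<open>4\<close> with leading coefficient \<open>6 / 4!\<close>.

  \<^emph>\<open>The dimension.\<close>  Passing to a proper irreducible closed subset lowers the order of growth of the
  Hilbert function by at least one (\<open>hilbert_fun_growth_drop\<close>), so chains in the variety have
  length at most four.  A flag of coordinate subspaces inside the variety shows that four is
  attained.\<close>

section \<open>Polynomial functions and their degree filtration\<close>

lemma fun_sum_apply: "(\<Sum>i\<in>I. f i) x = (\<Sum>i\<in>I. f i x :: complex)"
  by (induction I rule: infinite_finite_induct) auto

text \<open>The span form makes closure under linear combinations and the comparison with other
  filtrations instances of general facts on vector spaces.\<close>

lemma poly_funs_le_eq_span:
  "(poly_funs_le t :: (complex ^ 'n::finite \<Rightarrow> complex) set)
    = fun_vs.span (monomial_fun ` {\<alpha>. sum \<alpha> UNIV \<le> t})"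
proof (intro set_eqI iffI)
  fix f :: "complex ^ 'n \<Rightarrow> complex" assume "f \<in> poly_funs_le t"
  then obtain c where c: "f = (\<lambda>x. \<Sum>\<alpha>\<in>{\<alpha>. sum \<alpha> UNIV \<le> t}. c \<alpha> * monomial_fun \<alpha> x)"
    unfolding poly_funs_le_def by auto
  have "f = (\<Sum>\<alpha>\<in>{\<alpha>. sum \<alpha> UNIV \<le> t}. (\<lambda>x. c \<alpha> * monomial_fun \<alpha> x))"
    by (rule ext) (simp add: c fun_sum_apply)
  also have "\<dots> \<in> fun_vs.span (monomial_fun ` {\<alpha>. sum \<alpha> UNIV \<le> t})"
    by (intro fun_vs.span_sum fun_vs.span_scale fun_vs.span_base imageI)
  finally show "f \<in> fun_vs.span (monomial_fun ` {\<alpha>. sum \<alpha> UNIV \<le> t})" .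
next
  fix f :: "complex ^ 'n \<Rightarrow> complex"
  assume "f \<in> fun_vs.span (monomial_fun ` {\<alpha>. sum \<alpha> UNIV \<le> t})"
  then show "f \<in> poly_funs_le t"
  proof (induction rule: fun_vs.span_induct_alt)
    case base
    show ?case unfolding poly_funs_le_def
      by (auto intro!: exI[of _ "\<lambda>_. 0"] simp: fun_eq_iff)
  next
    case (step c m g)
    then obtain \<beta> d where b: "sum \<beta> UNIV \<le> t" "m = monomial_fun \<beta>"
      and d: "g = (\<lambda>x. \<Sum>\<alpha>\<in>{\<alpha>. sum \<alpha> UNIV \<le> t}. d \<alpha> * monomial_fun \<alpha> x)"
      unfolding poly_funs_le_def by auto
    let ?E = "{\<alpha> :: 'n \<Rightarrow> nat. sum \<alpha> UNIV \<le> t}"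
    have "((\<lambda>x. c * m x) + g) x = (\<Sum>\<alpha>\<in>?E. (d(\<beta> := c + d \<beta>)) \<alpha> * monomial_fun \<alpha> x)" for x
    proof -
      have "g x = d \<beta> * monomial_fun \<beta> x + (\<Sum>\<alpha>\<in>?E - {\<beta>}. d \<alpha> * monomial_fun \<alpha> x)"
        unfolding d using b by (subst sum.remove[OF finite_exponents_le, of \<beta>]) auto
      moreover have "(\<Sum>\<alpha>\<in>?E. (d(\<beta> := c + d \<beta>)) \<alpha> * monomial_fun \<alpha> x)
          = (c + d \<beta>) * monomial_fun \<beta> x + (\<Sum>\<alpha>\<in>?E - {\<beta>}. d \<alpha> * monomial_fun \<alpha> x)"
        using b by (subst sum.remove[OF finite_exponents_le, of \<beta>]) auto
      ultimately show ?thesis using b by (simp add: algebra_simps)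
    qed
    then show ?case unfolding poly_funs_le_def by (auto simp: fun_eq_iff)
  qed
qed

lemma subspace_poly_funs_le: "fun_vs.subspace (poly_funs_le t)"
  unfolding poly_funs_le_eq_span by (rule fun_vs.subspace_span)

lemma poly_funs_le_add: "f \<in> poly_funs_le t \<Longrightarrow> g \<in> poly_funs_le t \<Longrightarrow> (\<lambda>x. f x + g x) \<in> poly_funs_le t"
  using fun_vs.subspace_add[OF subspace_poly_funs_le] by (simp add: plus_fun_def)

lemma poly_funs_le_scale: "f \<in> poly_funs_le t \<Longrightarrow> (\<lambda>x. c * f x) \<in> poly_funs_le t"
  using fun_vs.subspace_scale[OF subspace_poly_funs_le] by blast

lemma poly_funs_le_uminus: "f \<in> poly_funs_le t \<Longrightarrow> (\<lambda>x. - f x) \<in> poly_funs_le t"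
  using poly_funs_le_scale[of f t "-1"] by simp

lemma poly_funs_le_diff: "f \<in> poly_funs_le t \<Longrightarrow> g \<in> poly_funs_le t \<Longrightarrow> (\<lambda>x. f x - g x) \<in> poly_funs_le t"
  using poly_funs_le_add[of f t "\<lambda>x. - g x"] poly_funs_le_uminus[of g t] by simp

lemma poly_funs_le_sum:
  "(\<And>i. i \<in> I \<Longrightarrow> f i \<in> poly_funs_le t) \<Longrightarrow> (\<lambda>x. \<Sum>i\<in>I. f i x) \<in> poly_funs_le t"
  using fun_vs.subspace_sum[OF subspace_poly_funs_le, of I f t] by (simp add: fun_sum_apply[abs_def])

lemma poly_funs_le_mono: "s \<le> t \<Longrightarrow> poly_funs_le s \<subseteq> poly_funs_le t"
  unfolding poly_funs_le_eq_span by (rule fun_vs.span_mono) auto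

lemma monomial_fun_mult: "monomial_fun \<alpha> x * monomial_fun \<beta> x = monomial_fun (\<lambda>i. \<alpha> i + \<beta> i) x"
  by (simp add: monomial_fun_def prod.distrib power_add)

lemma monomial_fun_in_poly_funs_le: "sum \<alpha> UNIV \<le> t \<Longrightarrow> monomial_fun \<alpha> \<in> poly_funs_le t"
  unfolding poly_funs_le_eq_span by (rule fun_vs.span_base) auto

lemma poly_funs_le_const: "(\<lambda>x. c) \<in> poly_funs_le t"
  using poly_funs_le_scale[OF monomial_fun_in_poly_funs_le[of "\<lambda>_. 0" t], of c]
  by (simp add: monomial_fun_def)

lemma monomial_fun_single: "monomial_fun (\<lambda>j. if j = i then 1 else 0) x = x $ i"
proof -
  have "monomial_fun (\<lambda>j. if j = i then 1 else 0) x = (\<Prod>j\<in>UNIV. if j = i then x $ j else 1)"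
    unfolding monomial_fun_def by (rule prod.cong) auto
  then show ?thesis by simp
qed

lemma poly_funs_le_coord: "t \<ge> 1 \<Longrightarrow> (\<lambda>x. x $ i) \<in> poly_funs_le t"
  using monomial_fun_in_poly_funs_le[of "\<lambda>j. if j = i then 1 else 0" t]
  by (simp add: monomial_fun_single[abs_def])

lemma poly_funs_le_mult:
  assumes "f \<in> poly_funs_le s" "g \<in> poly_funs_le t"
  shows "(\<lambda>x. f x * g x) \<in> poly_funs_le (s + t)"
proof -
  obtain c where c: "f = (\<lambda>x. \<Sum>\<alpha>\<in>{\<alpha>. sum \<alpha> UNIV \<le> s}. c \<alpha> * monomial_fun \<alpha> x)"
    using assms unfolding poly_funs_le_def by auto
  obtain d where d: "g = (\<lambda>x. \<Sum>\<alpha>\<in>{\<alpha>. sum \<alpha> UNIV \<le> t}. d \<alpha> * monomial_fun \<alpha> x)"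
    using assms unfolding poly_funs_le_def by auto
  have "(\<lambda>x. f x * g x) = (\<lambda>x. \<Sum>\<alpha>\<in>{\<alpha>. sum \<alpha> UNIV \<le> s}. \<Sum>\<beta>\<in>{\<beta>. sum \<beta> UNIV \<le> t}.
      (c \<alpha> * d \<beta>) * monomial_fun (\<lambda>i. \<alpha> i + \<beta> i) x)"
    by (auto simp: fun_eq_iff c d sum_product monomial_fun_mult[symmetric] algebra_simps intro!: sum.cong)
  also have "\<dots> \<in> poly_funs_le (s + t)"
    by (intro poly_funs_le_sum poly_funs_le_scale monomial_fun_in_poly_funs_le)
       (auto simp: sum.distrib intro!: add_mono)
  finally show ?thesis .
qed

lemma poly_funs_iff: "f \<in> poly_funs \<longleftrightarrow> (\<exists>t. f \<in> poly_funs_le t)"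
  by (auto simp: poly_funs_def)

lemma poly_funs_le_subset: "poly_funs_le t \<subseteq> poly_funs"
  by (auto simp: poly_funs_def)

lemma poly_funs_coord: "(\<lambda>x. x $ i) \<in> poly_funs"
  unfolding poly_funs_iff using poly_funs_le_coord[of 1] by blast

text \<open>The filtration is generated by multiplication with coordinates: anything that holds for
  constants and survives linear combinations and the step from \<open>g\<close> to \<open>x\<^sub>i * g\<close> holds for all
  polynomials, with degrees tracked.  The bound \<open>u\<close> allows the step to be available in low degrees
  only.\<close>

lemma poly_funs_le_subset_filtration:
  fixes Q :: "nat \<Rightarrow> (complex ^ 'n::finite \<Rightarrow> complex) set"
  assumes sub: "\<And>t. fun_vs.subspace (Q t)"
    and one: "\<And>t. (\<lambda>x. 1) \<in> Q t"
    and coord: "\<And>t i g. Suc t \<le> u \<Longrightarrow> g \<in> Q t \<Longrightarrow> (\<lambda>x. x $ i * g x) \<in> Q (Suc t)"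
    and mono: "\<And>t. Q t \<subseteq> Q (Suc t)"
    and "t \<le> u"
  shows "poly_funs_le t \<subseteq> Q t"
proof -
  have mon: "monomial_fun \<alpha> \<in> Q n" if "sum \<alpha> UNIV = n" "n \<le> u" for n \<alpha>
    using that
  proof (induction n arbitrary: \<alpha>)
    case 0
    then have "\<alpha> = (\<lambda>_. 0)" by auto
    then have "monomial_fun \<alpha> = (\<lambda>x. 1)" by (simp add: monomial_fun_def fun_eq_iff)
    then show ?case using one by simp
  next
    case (Suc n)
    then obtain i where i: "\<alpha> i \<noteq> 0"
      by (metis Zero_not_Suc sum.neutral)
    define \<beta> where "\<beta> = \<alpha>(i := \<alpha> i - 1)"
    have ab: "\<alpha> = (\<lambda>j. (if j = i then 1 else 0) + \<beta> j)"
      using i by (auto simp: \<beta>_def)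
    have "sum \<alpha> UNIV = 1 + sum \<beta> UNIV"
      by (subst ab) (simp add: sum.distrib)
    then have "sum \<beta> UNIV = n" using Suc.prems by simp
    then have "monomial_fun \<beta> \<in> Q n" using Suc by simp
    then have "(\<lambda>x. x $ i * monomial_fun \<beta> x) \<in> Q (Suc n)" using coord Suc.prems by simp
    also have "(\<lambda>x. x $ i * monomial_fun \<beta> x) = monomial_fun \<alpha>"
      by (subst ab) (simp add: fun_eq_iff monomial_fun_mult[symmetric] monomial_fun_single)
    finally show ?case .
  qed
  have Qm: "Q m \<subseteq> Q n" if "m \<le> n" for m n
    using lift_Suc_mono_le[of Q m n, OF _ that] mono by blast
  have "monomial_fun \<alpha> \<in> Q t" if "sum \<alpha> UNIV \<le> t" for \<alpha>
    using mon[of \<alpha> "sum \<alpha> UNIV"] that \<open>t \<le> u\<close> Qm[OF that] by auto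
  then show ?thesis
    unfolding poly_funs_le_eq_span by (intro fun_vs.span_minimal sub) auto
qed

section \<open>Zariski closures and irreducibility\<close>

lemma poly_curve_intros:
  "\<exists>p. \<forall>t. f t = poly p t \<Longrightarrow> \<exists>p. \<forall>t. g t = poly p t \<Longrightarrow> \<exists>p. \<forall>t. f t + g t = poly p t"
  "\<exists>p. \<forall>t. f t = poly p t \<Longrightarrow> \<exists>p. \<forall>t. g t = poly p t \<Longrightarrow> \<exists>p. \<forall>t. f t - g t = poly p t"
  "\<exists>p. \<forall>t. f t = poly p t \<Longrightarrow> \<exists>p. \<forall>t. g t = poly p t \<Longrightarrow> \<exists>p. \<forall>t. f t * g t = poly p t"
  "\<exists>p. \<forall>t. f t = poly p t \<Longrightarrow> \<exists>p. \<forall>t. f t ^ n = poly p t"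
  "\<exists>p. \<forall>t::complex. t = poly p t"
  "\<exists>p. \<forall>t::complex. c = poly p t"
  for f g :: "complex \<Rightarrow> complex"
proof -
  show "\<exists>p. \<forall>t::complex. c = poly p t" by (rule exI[of _ "[:c:]"]) simp
  show "\<exists>p. \<forall>t::complex. t = poly p t" by (rule exI[of _ "[:0, 1:]"]) simp
qed (metis poly_add, metis poly_diff, metis poly_mult, metis poly_power)

lemma poly_fun_along_curve:
  fixes \<gamma> :: "complex \<Rightarrow> complex ^ 'n::finite"
  assumes "f \<in> poly_funs" and "\<And>i. \<exists>p. \<forall>t. \<gamma> t $ i = poly p t"
  shows "\<exists>p. \<forall>t. f (\<gamma> t) = poly p t"
proof -
  obtain p where p: "\<And>i t. \<gamma> t $ i = poly (p i) t" using assms(2) by metis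
  obtain u c where c: "f = (\<lambda>x. \<Sum>\<alpha>\<in>{\<alpha>. sum \<alpha> UNIV \<le> u}. c \<alpha> * monomial_fun \<alpha> x)"
    using assms(1) unfolding poly_funs_iff poly_funs_le_def by auto
  have "f (\<gamma> t) = poly (\<Sum>\<alpha>\<in>{\<alpha>. sum \<alpha> UNIV \<le> u}. [:c \<alpha>:] * (\<Prod>i\<in>UNIV. p i ^ \<alpha> i)) t" for t
    by (simp add: c monomial_fun_def p poly_sum poly_prod)
  then show ?thesis by blast
qed

text \<open>Along a polynomial curve, a polynomial function that vanishes at all but finitely many
  parameters vanishes identically.\<close>

lemma poly_fun_vanishes_on_curve:
  fixes \<gamma> :: "complex \<Rightarrow> complex ^ 'n::finite"
  assumes "f \<in> poly_funs" "\<And>i. \<exists>p. \<forall>t. \<gamma> t $ i = poly p t"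
    and "finite F" "\<And>t. t \<notin> F \<Longrightarrow> f (\<gamma> t) = 0"
  shows "f (\<gamma> t) = 0"
proof -
  obtain p where p: "\<And>t. f (\<gamma> t) = poly p t" using poly_fun_along_curve[OF assms(1,2)] by blast
  have "\<not> finite {t. poly p t = 0}"
  proof
    assume "finite {t. poly p t = 0}"
    moreover have "UNIV \<subseteq> {t. poly p t = 0} \<union> F" using assms(4) p by auto
    ultimately have "finite (UNIV :: complex set)" using \<open>finite F\<close> by (meson finite_UnI finite_subset)
    then show False by (simp add: infinite_UNIV_char_0)
  qed
  then have "p = 0" using poly_roots_finite by blast
  then show ?thesis by (simp add: p)
qed

definition zariski_closure :: "(complex ^ 'n::finite) set \<Rightarrow> (complex ^ 'n) set" where
  "zariski_closure S = {x. \<forall>f\<in>poly_funs. (\<forall>s\<in>S. f s = 0) \<longrightarrow> f x = 0}"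

lemma zariski_closure_superset: "S \<subseteq> zariski_closure S"
  by (auto simp: zariski_closure_def)

lemma algebraic_set_zariski_closure: "algebraic_set (zariski_closure S)"
  unfolding algebraic_set_def
  by (rule exI[of _ "{f\<in>poly_funs. \<forall>s\<in>S. f s = 0}"]) (auto simp: zariski_closure_def)

lemma zariski_closure_curve:
  fixes \<gamma> :: "complex \<Rightarrow> complex ^ 'n::finite"
  assumes "\<And>i. \<exists>p. \<forall>t. \<gamma> t $ i = poly p t" "finite F" "\<And>t. t \<notin> F \<Longrightarrow> \<gamma> t \<in> zariski_closure S"
  shows "\<gamma> t \<in> zariski_closure S"
  using poly_fun_vanishes_on_curve[OF _ assms(1,2)] assms(3) unfolding zariski_closure_def by blast

lemma algebraic_set_separate:
  assumes "algebraic_set V" "x \<notin> V"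
  obtains f where "f \<in> poly_funs" "\<And>v. v \<in> V \<Longrightarrow> f v = 0" "f x \<noteq> 0"
  using assms unfolding algebraic_set_def by blast

lemma irreducible_variety_separate:
  assumes "irreducible_variety V" "V' \<subset> V" "irreducible_variety V'"
  obtains f where "f \<in> poly_funs" "\<And>v. v \<in> V' \<Longrightarrow> f v = 0" "\<exists>v\<in>V. f v \<noteq> 0"
  using assms algebraic_set_separate unfolding irreducible_variety_def by (metis psubset_imp_ex_mem DiffD1 DiffD2)

text \<open>Two nonvanishing polynomials restrict to nonzero univariate polynomials along a curve that
  meets a nonzero of each, so their product does not vanish on the set either.\<close>

lemma irreducible_zariski_closure:
  fixes S :: "(complex ^ 'n::finite) set"
  assumes "S \<noteq> {}"
    and curve: "\<And>a b. a \<in> S \<Longrightarrow> b \<in> S \<Longrightarrow>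
      \<exists>\<gamma>. (\<forall>i. \<exists>p. \<forall>t. \<gamma> t $ i = poly p t) \<and> range \<gamma> \<subseteq> S \<and> \<gamma> 0 = a \<and> \<gamma> 1 = b"
  shows "irreducible_variety (zariski_closure S)"
  unfolding irreducible_variety_def
proof (intro conjI allI impI)
  show "algebraic_set (zariski_closure S)" by (rule algebraic_set_zariski_closure)
  show "zariski_closure S \<noteq> {}" using zariski_closure_superset[of S] assms(1) by blast
next
  fix V1 V2 :: "(complex ^ 'n) set"
  assume asm: "algebraic_set V1 \<and> algebraic_set V2 \<and> zariski_closure S = V1 \<union> V2"
  have closed: "zariski_closure S \<subseteq> V" if "algebraic_set V" "S \<subseteq> V" for V
    using that unfolding algebraic_set_def zariski_closure_def by blast
  have "S \<subseteq> V1 \<or> S \<subseteq> V2"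
  proof (rule ccontr)
    assume "\<not> (S \<subseteq> V1 \<or> S \<subseteq> V2)"
    then obtain a b where ab: "a \<in> S" "a \<notin> V1" "b \<in> S" "b \<notin> V2" by blast
    obtain f where f: "f \<in> poly_funs" "\<And>v. v \<in> V1 \<Longrightarrow> f v = 0" "f a \<noteq> 0"
      using algebraic_set_separate asm ab by metis
    obtain g where g: "g \<in> poly_funs" "\<And>v. v \<in> V2 \<Longrightarrow> g v = 0" "g b \<noteq> 0"
      using algebraic_set_separate asm ab by metis
    obtain \<gamma> where \<gamma>: "\<And>i. \<exists>p. \<forall>t. \<gamma> t $ i = poly p t" "range \<gamma> \<subseteq> S" "\<gamma> 0 = a" "\<gamma> 1 = b"
      using curve[OF ab(1,3)] by blast
    obtain p where p: "\<And>t. f (\<gamma> t) = poly p t" using poly_fun_along_curve[OF f(1) \<gamma>(1)] by blast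
    obtain q where q: "\<And>t. g (\<gamma> t) = poly q t" using poly_fun_along_curve[OF g(1) \<gamma>(1)] by blast
    have "p \<noteq> 0" "q \<noteq> 0" using f(3) g(3) \<gamma>(3,4) p[of 0] q[of 1] by auto
    moreover have "poly (p * q) t = 0" for t
    proof -
      have "\<gamma> t \<in> V1 \<union> V2" using \<gamma>(2) asm zariski_closure_superset[of S] by blast
      then show ?thesis using f(2) g(2) p q by (metis UnE mult_eq_0_iff poly_mult)
    qed
    then have "p * q = 0" using poly_all_0_iff_0 by blast
    ultimately show False by simp
  qed
  then show "zariski_closure S = V1 \<or> zariski_closure S = V2"
    using closed asm by (metis Un_upper1 Un_upper2 subset_antisym)
qed

text \<open>The two factors cut the variety into two closed pieces, one of which is everything.\<close>

lemma irreducible_variety_mult_zero: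
  assumes "irreducible_variety V" "f \<in> poly_funs" "g \<in> poly_funs"
    and "\<And>v. v \<in> V \<Longrightarrow> f v * g v = 0" "\<exists>v\<in>V. f v \<noteq> 0" "v \<in> V"
  shows "g v = 0"
proof -
  obtain T where T: "T \<subseteq> poly_funs" "V = {x. \<forall>f\<in>T. f x = 0}"
    using assms(1) unfolding irreducible_variety_def algebraic_set_def by blast
  have cut: "algebraic_set {v\<in>V. h v = 0}" if "h \<in> poly_funs" for h
    unfolding algebraic_set_def by (rule exI[of _ "insert h T"]) (use T that in auto)
  have "V = {v\<in>V. f v = 0} \<union> {v\<in>V. g v = 0}" using assms(4) by auto
  then have "V = {v\<in>V. f v = 0} \<or> V = {v\<in>V. g v = 0}"
    using assms(1) cut[OF assms(2)] cut[OF assms(3)] unfolding irreducible_variety_def by blast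
  then show ?thesis using assms(5,6) by blast
qed

section \<open>Hilbert functions bound dimensions\<close>

definition restrict_fun :: "'a set \<Rightarrow> ('a \<Rightarrow> complex) \<Rightarrow> 'a \<Rightarrow> complex" where
  "restrict_fun V f = (\<lambda>x. if x \<in> V then f x else 0)"

lemma hilbert_fun_eq_dim: "hilbert_fun V t = fun_vs.dim (restrict_fun V ` poly_funs_le t)"
  by (simp add: hilbert_fun_def restrict_fun_def[abs_def])

interpretation fun_vs_pair:
  vector_space_pair "\<lambda>(c::complex) (f :: 'a \<Rightarrow> complex) x. c * f x"
    "\<lambda>(c::complex) (f :: 'a \<Rightarrow> complex) x. c * f x"
  by unfold_locales

lemma linear_restrict_fun:
  "Vector_Spaces.linear (\<lambda>c f x. c * f x) (\<lambda>c f x. c * f x) (restrict_fun V)"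
  by unfold_locales (auto simp: restrict_fun_def fun_eq_iff algebra_simps)

lemma linear_times_fun:
  fixes f :: "'a \<Rightarrow> complex"
  shows "Vector_Spaces.linear (\<lambda>c f x. c * f x) (\<lambda>c f x. c * f x) (\<lambda>h x. f x * h x)"
  by unfold_locales (auto simp: fun_eq_iff algebra_simps)

lemma restrict_fun_restrict_fun: "Z \<subseteq> V \<Longrightarrow> restrict_fun Z (restrict_fun V f) = restrict_fun Z f"
  by (auto simp: restrict_fun_def fun_eq_iff)

lemma restrict_fun_image_subset:
  "Z \<subseteq> V \<Longrightarrow> restrict_fun Z ` restrict_fun V ` P = restrict_fun Z ` P"
  by (simp add: image_image restrict_fun_restrict_fun)

lemma restrict_poly_funs_le_eq_span:
  "restrict_fun V ` poly_funs_le t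
    = fun_vs.span (restrict_fun V ` monomial_fun ` {\<alpha>. sum \<alpha> UNIV \<le> t})"
  unfolding poly_funs_le_eq_span by (rule fun_vs_pair.linear_span_image[OF linear_restrict_fun, symmetric])

text \<open>The ambient space of all functions has infinite dimension, so dimensions are compared relative
  to the finite spanning set of restricted monomials.\<close>

lemma finite_independent_restrict:
  assumes "fun_vs.independent B" "B \<subseteq> restrict_fun V ` poly_funs_le t"
  shows "finite B"
  using fun_vs.independent_span_bound[OF finite_imageI[OF finite_imageI[OF finite_exponents_le]]
      assms(1) assms(2)[unfolded restrict_poly_funs_le_eq_span]] by simp

lemma independent_card_le_hilbert_fun:
  assumes "fun_vs.independent B" "B \<subseteq> restrict_fun V ` poly_funs_le t"
  shows "card B \<le> hilbert_fun V t"
proof -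
  obtain C where C: "C \<subseteq> restrict_fun V ` poly_funs_le t" "fun_vs.independent C"
    "restrict_fun V ` poly_funs_le t \<subseteq> fun_vs.span C" "card C = hilbert_fun V t"
    unfolding hilbert_fun_eq_dim by (rule fun_vs.basis_exists)
  have "finite C" using finite_independent_restrict[OF C(2,1)] .
  have "B \<subseteq> fun_vs.span C" using assms(2) C(3) by (rule order_trans)
  then have "card B \<le> card C"
    using fun_vs.independent_span_bound[OF \<open>finite C\<close> assms(1)] by simp
  then show ?thesis using C(4) by simp
qed

lemma hilbert_fun_mono:
  assumes "s \<le> t"
  shows "hilbert_fun V s \<le> hilbert_fun V t"
proof -
  obtain B where B: "B \<subseteq> restrict_fun V ` poly_funs_le s" "fun_vs.independent B"
    "restrict_fun V ` poly_funs_le s \<subseteq> fun_vs.span B" "card B = hilbert_fun V s"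
    unfolding hilbert_fun_eq_dim by (rule fun_vs.basis_exists)
  have "B \<subseteq> restrict_fun V ` poly_funs_le t"
    using B(1) image_mono[OF poly_funs_le_mono[OF assms]] by (rule order_trans)
  then have "card B \<le> hilbert_fun V t" by (rule independent_card_le_hilbert_fun[OF B(2)])
  then show ?thesis using B(4) by simp
qed

lemma hilbert_fun_pos: "V \<noteq> {} \<Longrightarrow> hilbert_fun V t \<ge> 1"
proof -
  assume "V \<noteq> {}"
  let ?u = "restrict_fun V (\<lambda>_. 1)"
  have "?u \<noteq> 0" using \<open>V \<noteq> {}\<close> by (auto simp: restrict_fun_def fun_eq_iff)
  then have "fun_vs.independent {?u}"
    unfolding fun_vs.dependent_single by simp
  then have "card {?u} \<le> hilbert_fun V t"
    by (rule independent_card_le_hilbert_fun)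
       (simp only: insert_subset empty_subsetI simp_thms imageI[OF poly_funs_le_const])
  then show ?thesis by simp
qed

lemma hilbert_fun_le_card:
  assumes "finite B" "restrict_fun V ` poly_funs_le t \<subseteq> fun_vs.span B"
  shows "hilbert_fun V t \<le> card B"
  unfolding hilbert_fun_eq_dim by (rule fun_vs.dim_le_card[OF assms(2,1)])

lemma hilbert_fun_subset:
  assumes "Z \<subseteq> V"
  shows "hilbert_fun Z t \<le> hilbert_fun V t"
proof -
  obtain C where C: "C \<subseteq> restrict_fun V ` poly_funs_le t" "fun_vs.independent C"
    "restrict_fun V ` poly_funs_le t \<subseteq> fun_vs.span C" "card C = hilbert_fun V t"
    unfolding hilbert_fun_eq_dim by (rule fun_vs.basis_exists)
  have "finite C" using finite_independent_restrict[OF C(2,1)] .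
  have "restrict_fun Z ` poly_funs_le t \<subseteq> restrict_fun Z ` fun_vs.span C"
    using C(3) restrict_fun_image_subset[OF assms, of "poly_funs_le t"] by blast
  also have "\<dots> = fun_vs.span (restrict_fun Z ` C)"
    by (rule fun_vs_pair.linear_span_image[OF linear_restrict_fun, symmetric])
  finally have "hilbert_fun Z t \<le> card (restrict_fun Z ` C)"
    by (rule hilbert_fun_le_card[OF finite_imageI[OF \<open>finite C\<close>]])
  then show ?thesis using card_image_le[OF \<open>finite C\<close>, of "restrict_fun Z"] C(4) by simp
qed

text \<open>If \<open>f\<close> of degree at most \<open>e\<close> vanishes on \<open>Z\<close> but not on the irreducible \<open>V \<supseteq> Z\<close>, then
  multiplication by \<open>f\<close> embeds the functions of degree at most \<open>t\<close> on \<open>V\<close> into the kernel of the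
  restriction to \<open>Z\<close> of those of degree at most \<open>t + e\<close>.\<close>

lemma hilbert_fun_section:
  assumes V: "irreducible_variety V" and "Z \<subseteq> V"
    and f: "f \<in> poly_funs_le e" "\<And>v. v \<in> Z \<Longrightarrow> f v = 0" "\<exists>v\<in>V. f v \<noteq> 0"
  shows "hilbert_fun Z (t + e) + hilbert_fun V t \<le> hilbert_fun V (t + e)"
proof -
  let ?F = "\<lambda>h x. f x * h x"
  let ?R = "\<lambda>V t. restrict_fun V ` poly_funs_le t"
  obtain B0 where B0: "B0 \<subseteq> ?R V t" "fun_vs.independent B0"
    "?R V t \<subseteq> fun_vs.span B0" "card B0 = hilbert_fun V t"
    unfolding hilbert_fun_eq_dim by (rule fun_vs.basis_exists)
  have inj: "inj_on ?F (fun_vs.span (?R V t))"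
  proof (subst fun_vs_pair.linear_inj_on_iff_eq_0[OF linear_times_fun])
    show "fun_vs.subspace (fun_vs.span (?R V t))" by (rule fun_vs.subspace_span)
    show "\<forall>h\<in>fun_vs.span (?R V t). ?F h = 0 \<longrightarrow> h = 0"
    proof (intro ballI impI)
      fix h assume h: "h \<in> fun_vs.span (?R V t)" and 0: "?F h = 0"
      have "h \<in> ?R V t"
        using h unfolding restrict_poly_funs_le_eq_span fun_vs.span_span .
      then obtain g where g: "g \<in> poly_funs_le t" "h = restrict_fun V g" by blast
      have "f v * g v = 0" if "v \<in> V" for v
        using fun_cong[OF 0, of v] that by (simp add: g restrict_fun_def)
      then have "g v = 0" if "v \<in> V" for v
        using irreducible_variety_mult_zero[OF V, of f g v] f(1,3) g(1) that poly_funs_le_subset by blast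
      then show "h = 0" by (auto simp: g restrict_fun_def fun_eq_iff)
    qed
  qed
  have B0span: "fun_vs.span B0 \<subseteq> fun_vs.span (?R V t)" using B0(1) by (rule fun_vs.span_mono)
  have ind: "fun_vs.independent (?F ` B0)"
    by (rule fun_vs_pair.linear_independent_injective_image[OF linear_times_fun B0(2)])
       (rule inj_on_subset[OF inj B0span])
  have cardF: "card (?F ` B0) = hilbert_fun V t"
    using card_image[OF inj_on_subset[OF inj order_trans[OF B0(1) fun_vs.span_superset]]] B0(4)
    by simp
  have "?F ` B0 \<subseteq> ?R V (t + e)"
  proof clarify
    fix b assume "b \<in> B0"
    then obtain g where g: "g \<in> poly_funs_le t" "b = restrict_fun V g" using B0(1) by blast
    have "?F b = restrict_fun V (\<lambda>x. g x * f x)"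
      by (auto simp: g restrict_fun_def fun_eq_iff)
    then show "?F b \<in> ?R V (t + e)" using poly_funs_le_mult[OF g(1) f(1)] by blast
  qed
  then obtain B where B: "?F ` B0 \<subseteq> B" "B \<subseteq> ?R V (t + e)" "fun_vs.independent B"
    "?R V (t + e) \<subseteq> fun_vs.span B"
    by (rule fun_vs.maximal_independent_subset_extend[OF _ ind])
  have finB: "finite B" using finite_independent_restrict[OF B(3,2)] .
  have cardB: "card B = hilbert_fun V (t + e)"
    unfolding hilbert_fun_eq_dim by (rule fun_vs.basis_card_eq_dim[OF B(2,4,3)])
  have "restrict_fun Z (?F b) = 0" if "b \<in> B0" for b
    using f(2) by (auto simp: restrict_fun_def fun_eq_iff)
  then have sub: "restrict_fun Z ` B \<subseteq> insert 0 (restrict_fun Z ` (B - ?F ` B0))" by auto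
  have "?R Z (t + e) = restrict_fun Z ` ?R V (t + e)"
    by (simp add: restrict_fun_image_subset[OF \<open>Z \<subseteq> V\<close>])
  also have "\<dots> \<subseteq> restrict_fun Z ` fun_vs.span B" using B(4) by (rule image_mono)
  also have "\<dots> = fun_vs.span (restrict_fun Z ` B)"
    by (rule fun_vs_pair.linear_span_image[OF linear_restrict_fun, symmetric])
  also have "\<dots> \<subseteq> fun_vs.span (restrict_fun Z ` (B - ?F ` B0))"
    using fun_vs.span_mono[OF sub] by simp
  finally have "hilbert_fun Z (t + e) \<le> card (restrict_fun Z ` (B - ?F ` B0))"
    by (intro hilbert_fun_le_card) (use finB in auto)
  also have "\<dots> \<le> card (B - ?F ` B0)" using finB by (intro card_image_le) auto
  also have "\<dots> = card B - card (?F ` B0)"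
    using finB B(1) by (intro card_Diff_subset) (auto intro: finite_subset)
  finally have le: "hilbert_fun Z (t + e) \<le> card B - card (?F ` B0)" .
  have "card (?F ` B0) \<le> card B" using finB B(1) by (rule card_mono)
  then show ?thesis using le cardF cardB by simp
qed

text \<open>Sum of the section inequality over the degrees \<open>T + e, T + 2e, \<dots>, T + me\<close>, in each of which
  \<open>H\<^sub>Z\<close> is at least \<open>H\<^sub>Z(T)\<close>.\<close>

lemma hilbert_fun_telescope:
  assumes V: "irreducible_variety V" and "Z \<subseteq> V"
    and f: "f \<in> poly_funs_le e" "\<And>v. v \<in> Z \<Longrightarrow> f v = 0" "\<exists>v\<in>V. f v \<noteq> 0"
  shows "m * hilbert_fun Z T \<le> hilbert_fun V (T + m * e)"
proof (induction m)
  case (Suc m)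
  have "hilbert_fun Z T \<le> hilbert_fun Z ((T + m * e) + e)"
    by (rule hilbert_fun_mono) simp
  then show ?case
    using Suc hilbert_fun_section[OF assms, of "T + m * e"] by (simp add: algebra_simps)
qed simp

text \<open>With \<open>m = T + 1\<close> the telescoped inequality compares \<open>(T + 1) * H\<^sub>Z(T)\<close> with \<open>H\<^sub>V\<close> at an argument of
  size \<open>O(T)\<close>, which removes one power of \<open>T\<close>.  For \<open>d = 0\<close> arbitrarily large \<open>m\<close> contradict
  \<open>H\<^sub>Z \<ge> 1\<close>.\<close>

lemma hilbert_fun_growth_drop:
  assumes "irreducible_variety V" "irreducible_variety Z" "Z \<subset> V"
    and bound: "\<And>t. hilbert_fun V t \<le> c * (t + 1) ^ d"
  shows "d > 0 \<and> (\<exists>c'. \<forall>t. hilbert_fun Z t \<le> c' * (t + 1) ^ (d - 1))"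
proof -
  obtain f where "f \<in> poly_funs" and f: "\<And>v. v \<in> Z \<Longrightarrow> f v = 0" "\<exists>v\<in>V. f v \<noteq> 0"
    using irreducible_variety_separate[OF assms(1,3,2)] by blast
  then obtain e where e: "f \<in> poly_funs_le e" by (auto simp: poly_funs_iff)
  have tele: "m * hilbert_fun Z T \<le> c * (T + m * e + 1) ^ d" for m T
    using hilbert_fun_telescope[OF assms(1) _ e f] assms(3) bound order_trans by blast
  show ?thesis
  proof
    show d: "d > 0"
    proof (rule ccontr)
      assume "\<not> d > 0"
      then have "Suc c * hilbert_fun Z 0 \<le> c" using tele[of "Suc c" 0] by simp
      moreover have "Z \<noteq> {}" using assms(2) unfolding irreducible_variety_def by simp
      then have "hilbert_fun Z 0 \<ge> 1" by (rule hilbert_fun_pos)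
      then have "Suc c * 1 \<le> Suc c * hilbert_fun Z 0" by (rule mult_le_mono2)
      ultimately have "Suc c * 1 \<le> c" by (rule order_trans[rotated])
      then show False by simp
    qed
    have "hilbert_fun Z T \<le> (c * (e + 1) ^ d) * (T + 1) ^ (d - 1)" for T
    proof -
      have "(T + 1) * hilbert_fun Z T \<le> c * ((e + 1) * (T + 1)) ^ d"
        using tele[of "T + 1" T] by (simp add: algebra_simps)
      also have "\<dots> = (T + 1) * ((c * (e + 1) ^ d) * (T + 1) ^ (d - 1))"
        using d by (cases d) (simp_all only: power_mult_distrib, simp_all add: algebra_simps)
      finally show ?thesis by (simp only: mult_le_cancel1)
    qed
    then show "\<exists>c'. \<forall>t. hilbert_fun Z t \<le> c' * (t + 1) ^ (d - 1)" by blast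
  qed
qed

lemma irreducible_chain_length_le:
  fixes Z :: "nat \<Rightarrow> (complex ^ 'n::finite) set"
  assumes "\<And>i. i \<le> k \<Longrightarrow> irreducible_variety (Z i)" "\<And>i. i < k \<Longrightarrow> Z i \<subset> Z (Suc i)"
    and "\<And>t. hilbert_fun (Z k) t \<le> c * (t + 1) ^ d"
  shows "k \<le> d"
  using assms
proof (induction k arbitrary: c d)
  case (Suc k)
  obtain c' where c: "d > 0" "\<And>t. hilbert_fun (Z k) t \<le> c' * (t + 1) ^ (d - 1)"
    using hilbert_fun_growth_drop[of "Z (Suc k)" "Z k" c d] Suc.prems by auto
  have "k \<le> d - 1" using Suc.IH[of c' "d - 1"] Suc.prems(1,2) c(2) by simp
  then show ?case using c(1) by linarith
qed simp

lemma variety_dim_le: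
  assumes "\<And>t. hilbert_fun V t \<le> c * (t + 1) ^ d"
  shows "variety_dim V \<le> enat d"
  unfolding variety_dim_def
proof (rule Sup_least, clarify)
  fix k and Z :: "nat \<Rightarrow> (complex ^ 'a) set"
  assume Z: "\<forall>i\<le>k. irreducible_variety (Z i) \<and> Z i \<subseteq> V" "\<forall>i<k. Z i \<subset> Z (Suc i)"
  then have "hilbert_fun (Z k) t \<le> c * (t + 1) ^ d" for t
    using hilbert_fun_subset[of "Z k" V t] assms[of t] by (meson order_refl order_trans)
  then show "enat k \<le> enat d" using irreducible_chain_length_le[of k Z c d] Z by simp
qed

section \<open>Squared distances of four concyclic points\<close>

lemma exhaust_6:
  fixes i :: 6
  shows "i = 1 \<or> i = 2 \<or> i = 3 \<or> i = 4 \<or> i = 5 \<or> i = 6"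
proof (induct i)
  case (of_int z)
  then have "z = 0 \<or> z = 1 \<or> z = 2 \<or> z = 3 \<or> z = 4 \<or> z = 5" by fastforce
  then show ?case by auto
qed

lemma forall_6: "(\<forall>i::6. P i) \<longleftrightarrow> P 1 \<and> P 2 \<and> P 3 \<and> P 4 \<and> P 5 \<and> P 6"
  by (metis exhaust_6)

lemma UNIV_6: "UNIV = {1, 2, 3, 4, 5, 6 :: 6}"
  using exhaust_6 by auto

lemma sum_6: "sum f (UNIV :: 6 set) = f 1 + f 2 + f 3 + f 4 + f 5 + f 6"
  unfolding UNIV_6 by (simp add: add.assoc)

lemma vector_6 [simp]:
  "(vector [a, b, c, d, e, f] :: 'a::zero ^ 6) $ 1 = a"
  "(vector [a, b, c, d, e, f] :: 'a::zero ^ 6) $ 2 = b"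
  "(vector [a, b, c, d, e, f] :: 'a::zero ^ 6) $ 3 = c"
  "(vector [a, b, c, d, e, f] :: 'a::zero ^ 6) $ 4 = d"
  "(vector [a, b, c, d, e, f] :: 'a::zero ^ 6) $ 5 = e"
  "(vector [a, b, c, d, e, f] :: 'a::zero ^ 6) $ 6 = f"
  unfolding vector_def by simp_all

text \<open>With \<open>s\<close> scaled by \<open>x * y * z\<close> the squared distances \<open>s * (u - v)\<^sup>2 / (u * v)\<close> between the points of
  parameters \<open>x, y, z, 1\<close> become polynomial.  The entries follow the coordinates \<open>A, B, C, X, Y, Z\<close>:
  the first three are the sides of the triangle \<open>x, y, z\<close>, the last three the distances to \<open>1\<close>.\<close>

definition concyclic_dist :: "complex \<Rightarrow> complex \<Rightarrow> complex \<Rightarrow> complex \<Rightarrow> complex ^ 6" where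
  "concyclic_dist s x y z = vector
    [s * (y - z)\<^sup>2 * x, s * (x - z)\<^sup>2 * y, s * (x - y)\<^sup>2 * z,
     s * (x - 1)\<^sup>2 * (y * z), s * (y - 1)\<^sup>2 * (x * z), s * (z - 1)\<^sup>2 * (x * y)]"

definition concyclic_variety :: "(complex ^ 6) set" where
  "concyclic_variety = zariski_closure {concyclic_dist s x y z |s x y z. True}"

lemma concyclic_dist_in_variety: "concyclic_dist s x y z \<in> concyclic_variety"
  unfolding concyclic_variety_def
  by (rule subsetD[OF zariski_closure_superset]) auto

lemma irreducible_concyclic_variety: "irreducible_variety concyclic_variety"
  unfolding concyclic_variety_def
proof (rule irreducible_zariski_closure)
  fix a b assume "a \<in> {concyclic_dist s x y z |s x y z. True}" "b \<in> {concyclic_dist s x y z |s x y z. True}"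
  then obtain s x y z s' x' y' z' where ab: "a = concyclic_dist s x y z" "b = concyclic_dist s' x' y' z'"
    by blast
  let ?\<gamma> = "\<lambda>t. concyclic_dist (s + t * (s' - s)) (x + t * (x' - x)) (y + t * (y' - y)) (z + t * (z' - z))"
  show "\<exists>\<gamma>. (\<forall>i. \<exists>p. \<forall>t. \<gamma> t $ i = poly p t) \<and>
      range \<gamma> \<subseteq> {concyclic_dist s x y z |s x y z. True} \<and> \<gamma> 0 = a \<and> \<gamma> 1 = b"
  proof (rule exI[of _ ?\<gamma>], intro conjI)
    show "\<forall>i. \<exists>p. \<forall>t. ?\<gamma> t $ i = poly p t"
      unfolding forall_6 concyclic_dist_def vector_6 by (intro conjI poly_curve_intros)
    show "range ?\<gamma> \<subseteq> {concyclic_dist s x y z |s x y z. True}" by blast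
    show "?\<gamma> 0 = a" "?\<gamma> 1 = b" by (simp_all add: ab)
  qed
qed blast

lemma poly_fun_vanishes_on_concyclic_variety:
  assumes "f \<in> poly_funs" "\<And>s x y z. f (concyclic_dist s x y z) = 0" "w \<in> concyclic_variety"
  shows "f w = 0"
  using assms unfolding concyclic_variety_def zariski_closure_def by blast

lemmas poly_funs_le_intros =
  poly_funs_le_add poly_funs_le_diff poly_funs_le_uminus poly_funs_le_scale poly_funs_le_const
  poly_funs_le_coord

definition det3 :: "complex \<Rightarrow> complex \<Rightarrow> complex \<Rightarrow> complex \<Rightarrow> complex \<Rightarrow> complex \<Rightarrow> complex \<Rightarrow> complex \<Rightarrow> complex \<Rightarrow> complex"
  where "det3 a b c d e f g h i = a * e * i - a * f * h + b * f * g - b * d * i + c * d * h - c * e * g"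

text \<open>Each row \<open>i\<close> is a multiple of \<open>P - k\<^sub>i U\<close>, so all three rows lie in the plane spanned by \<open>P\<close> and
  \<open>U\<close>.\<close>

lemma det3_rank_two:
  "det3 (a * (p - k * u)) (a * (q - k * v)) (a * (r - k * w))
        (b * (p - l * u)) (b * (q - l * v)) (b * (r - l * w))
        (c * (p - m * u)) (c * (q - m * v)) (c * (r - m * w)) = 0"
proof -
  have "det3 (p - k * u) (q - k * v) (r - k * w) (p - l * u) (q - l * v) (r - l * w)
        (p - m * u) (q - m * v) (r - m * w) = 0"
    unfolding det3_def by algebra
  moreover have "det3 (a * p1) (a * p2) (a * p3) (b * q1) (b * q2) (b * q3) (c * r1) (c * r2) (c * r3)
      = a * b * c * det3 p1 p2 p3 q1 q2 q3 r1 r2 r3" for p1 p2 p3 q1 q2 q3 r1 r2 r3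
    unfolding det3_def by algebra
  ultimately show ?thesis by simp
qed

text \<open>Row \<open>i\<close> of the matrix of squared distances of \<open>v\<^sub>0, v\<^sub>1, v\<^sub>2, P\<close> minus its last row.\<close>

definition dist_diff :: "nat \<Rightarrow> nat \<Rightarrow> complex ^ 6 \<Rightarrow> complex" where
  "dist_diff i j w =
    ([[- w $ 4, w $ 3 - w $ 5, w $ 2 - w $ 6, w $ 4],
      [w $ 3 - w $ 4, - w $ 5, w $ 1 - w $ 6, w $ 5],
      [w $ 2 - w $ 4, w $ 1 - w $ 5, - w $ 6, w $ 6]] ! i) ! j"

text \<open>Since \<open>(u - v)\<^sup>2 / (u * v) = u / v + v / u - 2\<close>, the difference of the entries for \<open>u\<close> and for \<open>1\<close>
  in the column of \<open>v\<close> is \<open>(u - 1) * (1 / v - v / u)\<close>: a combination of the two row vectors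
  \<open>1 / v\<close> and \<open>v\<close> with coefficients that depend on the row only.\<close>

lemma dist_diff_concyclic:
  "dist_diff 0 j (concyclic_dist s x y z) = s * (x - 1) * ([y * z, x * z, x * y, x * y * z] ! j - y * z * [x, y, z, 1] ! j)"
  "dist_diff 1 j (concyclic_dist s x y z) = s * (y - 1) * ([y * z, x * z, x * y, x * y * z] ! j - x * z * [x, y, z, 1] ! j)"
  "dist_diff 2 j (concyclic_dist s x y z) = s * (z - 1) * ([y * z, x * z, x * y, x * y * z] ! j - x * y * [x, y, z, 1] ! j)"
  if "j < 4"
proof -
  have "j = 0 \<or> j = 1 \<or> j = 2 \<or> j = 3" using that by linarith
  then show "dist_diff 0 j (concyclic_dist s x y z) = s * (x - 1) * ([y * z, x * z, x * y, x * y * z] ! j - y * z * [x, y, z, 1] ! j)"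
    "dist_diff 1 j (concyclic_dist s x y z) = s * (y - 1) * ([y * z, x * z, x * y, x * y * z] ! j - x * z * [x, y, z, 1] ! j)"
    "dist_diff 2 j (concyclic_dist s x y z) = s * (z - 1) * ([y * z, x * z, x * y, x * y * z] ! j - x * y * [x, y, z, 1] ! j)"
    by (auto simp: dist_diff_def concyclic_dist_def power2_eq_square algebra_simps)
qed

lemma dist_diff_poly: "i < 3 \<Longrightarrow> j < 4 \<Longrightarrow> dist_diff i j \<in> poly_funs_le 1"
proof -
  assume "i < 3" "j < 4"
  then have i: "i = 0 \<or> i = 1 \<or> i = 2" and j: "j = 0 \<or> j = 1 \<or> j = 2 \<or> j = 3" by linarith+
  have [simp]: "(\<lambda>x. x $ k) \<in> poly_funs_le (Suc 0)" "(\<lambda>x. - x $ k) \<in> poly_funs_le (Suc 0)"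
    "(\<lambda>x. x $ k - x $ l) \<in> poly_funs_le (Suc 0)" for k l :: 6
    by (intro poly_funs_le_intros; simp)+
  show ?thesis using i j unfolding dist_diff_def[abs_def]
    by (elim disjE) simp_all
qed

lemma minor_vanishes:
  assumes "w \<in> concyclic_variety" "j < 4" "k < 4" "l < 4"
  shows "det3 (dist_diff 0 j w) (dist_diff 0 k w) (dist_diff 0 l w)
              (dist_diff 1 j w) (dist_diff 1 k w) (dist_diff 1 l w)
              (dist_diff 2 j w) (dist_diff 2 k w) (dist_diff 2 l w) = 0"
proof (rule poly_fun_vanishes_on_concyclic_variety[OF _ _ assms(1)])
  have p: "(\<lambda>w. dist_diff a b w * dist_diff c d w * dist_diff e f w) \<in> poly_funs_le 3"
    if "a < 3" "b < 4" "c < 3" "d < 4" "e < 3" "f < 4" for a b c d e f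
    using poly_funs_le_mult[OF poly_funs_le_mult[OF dist_diff_poly[OF that(1,2)]
      dist_diff_poly[OF that(3,4)]] dist_diff_poly[OF that(5,6)]] by (simp add: eval_nat_numeral)
  show "(\<lambda>w. det3 (dist_diff 0 j w) (dist_diff 0 k w) (dist_diff 0 l w)
              (dist_diff 1 j w) (dist_diff 1 k w) (dist_diff 1 l w)
              (dist_diff 2 j w) (dist_diff 2 k w) (dist_diff 2 l w)) \<in> poly_funs"
    unfolding det3_def
    by (rule subsetD[OF poly_funs_le_subset[of 3]], intro poly_funs_le_add poly_funs_le_diff p)
       (use assms in auto)
qed (simp only: dist_diff_concyclic[OF assms(2)] dist_diff_concyclic[OF assms(3)]
    dist_diff_concyclic[OF assms(4)] det3_rank_two)

section \<open>Spanning the functions on the variety\<close>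

text \<open>A homogeneous system of parameters for the coordinate ring.  On the projective plane where the last three
  forms vanish, \<open>(A, B, C) = - (X, Y, Z)\<close>, and the variety meets that plane in the
  six points \<open>(X, Y, Z) = (0, 1, \<plusminus>1), (1, 0, \<plusminus>1), (1, \<plusminus>1, 0)\<close>; the first form vanishes at none of
  them.\<close>

definition hsop :: "nat \<Rightarrow> complex ^ 6 \<Rightarrow> complex" where
  "hsop k w = [2 * w $ 5 + w $ 6, w $ 1 + w $ 4, w $ 2 + w $ 5, w $ 3 + w $ 6] ! k"

lemma hsop_simps:
  "hsop 0 w = 2 * w $ 5 + w $ 6" "hsop 1 w = w $ 1 + w $ 4"
  "hsop 2 w = w $ 2 + w $ 5" "hsop 3 w = w $ 3 + w $ 6"
  "hsop (Suc 0) w = w $ 1 + w $ 4"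
  by (simp_all add: hsop_def)

lemma hsop_poly: "k < 4 \<Longrightarrow> hsop k \<in> poly_funs_le 1"
proof -
  assume "k < 4"
  then have "k = 0 \<or> k = 1 \<or> k = 2 \<or> k = 3" by linarith
  then show ?thesis
    by (elim disjE; hypsubst; subst hsop_simps[abs_def]; intro poly_funs_le_intros) auto
qed

definition hsop_span :: "(complex ^ 6 \<Rightarrow> complex) set" where
  "hsop_span = {f. \<exists>c. \<forall>w. f w = (\<Sum>k<4. c k * hsop k w)}"

text \<open>Functions that agree on the variety with elements of the ideal of the \<open>h\<^sub>k\<close>, with cofactors of
  degree at most two.\<close>

definition hsop_multiples :: "(complex ^ 6 \<Rightarrow> complex) set" where
  "hsop_multiples = {f. \<exists>q. (\<forall>k<4. q k \<in> poly_funs_le 2) \<and>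
    (\<forall>w\<in>concyclic_variety. f w = (\<Sum>k<4. hsop k w * q k w))}"

lemma hsop_multiples_cong:
  "f \<in> hsop_multiples \<Longrightarrow> (\<And>w. w \<in> concyclic_variety \<Longrightarrow> f w = g w) \<Longrightarrow> g \<in> hsop_multiples"
  unfolding hsop_multiples_def by auto

lemma hsop_multiples_add:
  assumes "f \<in> hsop_multiples" "g \<in> hsop_multiples"
  shows "(\<lambda>w. f w + g w) \<in> hsop_multiples"
proof -
  obtain q r where "\<forall>k<4. q k \<in> poly_funs_le 2" "\<forall>k<4. r k \<in> poly_funs_le 2"
    "\<forall>w\<in>concyclic_variety. f w = (\<Sum>k<4. hsop k w * q k w)"
    "\<forall>w\<in>concyclic_variety. g w = (\<Sum>k<4. hsop k w * r k w)"
    using assms unfolding hsop_multiples_def by auto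
  then show ?thesis unfolding hsop_multiples_def
    by (intro CollectI exI[of _ "\<lambda>k w. q k w + r k w"])
       (auto simp: algebra_simps sum.distrib intro: poly_funs_le_add)
qed

lemma hsop_multiples_scale:
  assumes "f \<in> hsop_multiples"
  shows "(\<lambda>w. c * f w) \<in> hsop_multiples"
proof -
  obtain q where "\<forall>k<4. q k \<in> poly_funs_le 2"
    "\<forall>w\<in>concyclic_variety. f w = (\<Sum>k<4. hsop k w * q k w)"
    using assms unfolding hsop_multiples_def by auto
  then show ?thesis unfolding hsop_multiples_def
    by (intro CollectI exI[of _ "\<lambda>k w. c * q k w"])
       (auto simp: algebra_simps sum_distrib_left intro: poly_funs_le_scale)
qed

lemma hsop_multiples_diff:
  "f \<in> hsop_multiples \<Longrightarrow> g \<in> hsop_multiples \<Longrightarrow> (\<lambda>w. f w - g w) \<in> hsop_multiples"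
  using hsop_multiples_add[of f "\<lambda>w. -1 * g w"] hsop_multiples_scale[of g "-1"] by simp

lemma hsop_multiples_mult:
  assumes "f \<in> hsop_span" "g \<in> poly_funs_le 1" "h \<in> poly_funs_le 1"
  shows "(\<lambda>w. f w * g w * h w) \<in> hsop_multiples"
proof -
  obtain c where c: "\<And>w. f w = (\<Sum>k<4. c k * hsop k w)" using assms(1) unfolding hsop_span_def by auto
  have "(\<lambda>w. g w * h w) \<in> poly_funs_le 2" using poly_funs_le_mult[OF assms(2,3)] by (simp add: eval_nat_numeral)
  then show ?thesis unfolding hsop_multiples_def
    by (intro CollectI exI[of _ "\<lambda>k w. c k * (g w * h w)"])
       (auto simp: c sum_distrib_right sum_distrib_left algebra_simps intro: poly_funs_le_scale)
qed

text \<open>Replacing the three factors one at a time: \<open>fgh - f'g'h' = (f-f')gh + f'(g-g')h + f'g'(h-h')\<close>.\<close>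

lemma hsop_multiples_mult3_diff:
  assumes "(\<lambda>w. f w - f' w) \<in> hsop_span" "(\<lambda>w. g w - g' w) \<in> hsop_span" "(\<lambda>w. h w - h' w) \<in> hsop_span"
    and "g \<in> poly_funs_le 1" "h \<in> poly_funs_le 1" "f' \<in> poly_funs_le 1" "g' \<in> poly_funs_le 1"
  shows "(\<lambda>w. f w * g w * h w - f' w * g' w * h' w) \<in> hsop_multiples"
  using hsop_multiples_add[OF hsop_multiples_add[OF hsop_multiples_mult[OF assms(1,4,5)]
      hsop_multiples_mult[OF assms(2,6,5)]] hsop_multiples_mult[OF assms(3,6,7)]]
  by (rule hsop_multiples_cong) (simp add: algebra_simps)

text \<open>The matrix of row differences after the substitution that makes all \<open>h\<^sub>k\<close> vanish:
  \<open>A = - X\<close>, \<open>B = - Y\<close>, \<open>C = 2 Y\<close>, \<open>Z = - 2 Y\<close>.\<close>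

definition dist_diff_plane :: "nat \<Rightarrow> nat \<Rightarrow> complex ^ 6 \<Rightarrow> complex" where
  "dist_diff_plane i j w =
    ([[- w $ 4, w $ 5, w $ 5, w $ 4],
      [2 * w $ 5 - w $ 4, - w $ 5, 2 * w $ 5 - w $ 4, w $ 5],
      [- w $ 4 - w $ 5, - w $ 4 - w $ 5, 2 * w $ 5, - 2 * w $ 5]] ! i) ! j"

lemma dist_diff_plane_poly: "i < 3 \<Longrightarrow> j < 4 \<Longrightarrow> dist_diff_plane i j \<in> poly_funs_le 1"
proof -
  assume "i < 3" "j < 4"
  then have i: "i = 0 \<or> i = 1 \<or> i = 2" and j: "j = 0 \<or> j = 1 \<or> j = 2 \<or> j = 3" by linarith+
  have [simp]: "(\<lambda>x. x $ k) \<in> poly_funs_le (Suc 0)" "(\<lambda>x. - x $ k) \<in> poly_funs_le (Suc 0)"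
    "(\<lambda>x. - x $ k - x $ l) \<in> poly_funs_le (Suc 0)"
    "(\<lambda>x. 2 * x $ k - x $ l) \<in> poly_funs_le (Suc 0)"
    "(\<lambda>x. 2 * x $ k) \<in> poly_funs_le (Suc 0)"
    "(\<lambda>x. - (2 * x $ k)) \<in> poly_funs_le (Suc 0)" for k l :: 6
    by (intro poly_funs_le_intros; simp)+
  show ?thesis using i j unfolding dist_diff_plane_def[abs_def]
    by (elim disjE) simp_all
qed

lemma dist_diff_cong:
  assumes "i < 3" "j < 4"
  shows "(\<lambda>w. dist_diff i j w - dist_diff_plane i j w) \<in> hsop_span"
proof -
  have i: "i = 0 \<or> i = 1 \<or> i = 2" and j: "j = 0 \<or> j = 1 \<or> j = 2 \<or> j = 3" using assms by linarith+
  have "\<exists>a b c d. \<forall>w. dist_diff i j w - dist_diff_plane i j w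
      = a * hsop 0 w + b * hsop 1 w + c * hsop 2 w + d * hsop 3 w" (is ?P)
    by (rule exI[of _ "([[0, -1, -1, 0], [-1, 0, -1, 0], [0, 0, -1, 1]] ! i) ! j"],
        rule exI[of _ "([[0, 0, 0, 0], [0, 0, 1, 0], [0, 1, 0, 0]] ! i) ! j"],
        rule exI[of _ "([[0, 0, 1, 0], [0, 0, 0, 0], [1, 0, 0, 0]] ! i) ! j"],
        rule exI[of _ "([[0, 1, 0, 0], [1, 0, 0, 0], [0, 0, 0, 0]] ! i) ! j"])
       (use i j in \<open>elim disjE; simp add: dist_diff_def dist_diff_plane_def hsop_simps\<close>)
  then obtain a b c d where "\<And>w. dist_diff i j w - dist_diff_plane i j w
      = a * hsop 0 w + b * hsop 1 w + c * hsop 2 w + d * hsop 3 w" by blast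
  then show ?thesis unfolding hsop_span_def
    by (intro CollectI exI[of _ "\<lambda>k. [a, b, c, d] ! k"])
       (simp add: eval_nat_numeral)
qed

text \<open>The minors of the two matrices are congruent modulo the \<open>h\<^sub>k\<close>, and those of the row differences
  vanish on the variety.\<close>

lemma det3_plane_in_hsop_multiples:
  assumes "j < 4" "k < 4" "l < 4"
  shows "(\<lambda>w. det3 (dist_diff_plane 0 j w) (dist_diff_plane 0 k w) (dist_diff_plane 0 l w)
      (dist_diff_plane 1 j w) (dist_diff_plane 1 k w) (dist_diff_plane 1 l w)
      (dist_diff_plane 2 j w) (dist_diff_plane 2 k w) (dist_diff_plane 2 l w)) \<in> hsop_multiples"
proof -
  let ?T = "\<lambda>a b c w. dist_diff 0 a w * dist_diff 1 b w * dist_diff 2 c w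
      - dist_diff_plane 0 a w * dist_diff_plane 1 b w * dist_diff_plane 2 c w"
  have T: "?T a b c \<in> hsop_multiples" if "a < 4" "b < 4" "c < 4" for a b c
    by (intro hsop_multiples_mult3_diff dist_diff_cong dist_diff_poly dist_diff_plane_poly)
       (use that in simp_all)
  have "(\<lambda>w. -1 * (?T j k l w - ?T j l k w + ?T k l j w - ?T k j l w + ?T l j k w - ?T l k j w))
      \<in> hsop_multiples"
    using assms by (intro hsop_multiples_scale hsop_multiples_add hsop_multiples_diff T)
  then show ?thesis
  proof (rule hsop_multiples_cong)
    fix w assume "w \<in> concyclic_variety"
    from minor_vanishes[OF this assms]
    show "-1 * (?T j k l w - ?T j l k w + ?T k l j w - ?T k j l w + ?T l j k w - ?T l k j w) =
      det3 (dist_diff_plane 0 j w) (dist_diff_plane 0 k w) (dist_diff_plane 0 l w)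
      (dist_diff_plane 1 j w) (dist_diff_plane 1 k w) (dist_diff_plane 1 l w)
      (dist_diff_plane 2 j w) (dist_diff_plane 2 k w) (dist_diff_plane 2 l w)"
      unfolding det3_def by (simp add: algebra_simps)
  qed
qed

text \<open>The four minors on the plane are linearly independent binary cubics in \<open>X, Y\<close>, hence a basis of
  the binary cubics.\<close>

lemma cubic_in_hsop_multiples:
  assumes "g + h = 3"
  shows "(\<lambda>w. w $ 4 ^ g * w $ 5 ^ h) \<in> hsop_multiples"
proof -
  define m where "m j k l w = det3 (dist_diff_plane 0 j w) (dist_diff_plane 0 k w) (dist_diff_plane 0 l w)
      (dist_diff_plane 1 j w) (dist_diff_plane 1 k w) (dist_diff_plane 1 l w)
      (dist_diff_plane 2 j w) (dist_diff_plane 2 k w) (dist_diff_plane 2 l w)" for j k l w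
  have m: "m j k l \<in> hsop_multiples" if "j < 4" "k < 4" "l < 4" for j k l
    unfolding m_def[abs_def] using det3_plane_in_hsop_multiples[OF that] .
  (* The coefficients used below form the inverse of the coefficient matrix of the minors. *)
  have comb: "(\<lambda>w. a * m 0 1 2 w + b * m 0 1 3 w + c * m 0 2 3 w + d * m 1 2 3 w)
      \<in> hsop_multiples" for a b c d
    by (intro hsop_multiples_add hsop_multiples_scale m) auto
  have vals: "m 0 1 2 w = w$4^3 + w$4^2 * w$5 - w$4 * w$5^2 - 9 * w$5^3"
    "m 0 1 3 w = w$4^3 - 3 * w$4^2 * w$5 - 9 * w$4 * w$5^2 + 3 * w$5^3"
    "m 0 2 3 w = - (w$4^3) - 3 * w$4^2 * w$5 + 9 * w$4 * w$5^2 + 3 * w$5^3"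
    "m 1 2 3 w = - (w$4^3) + w$4^2 * w$5 + w$4 * w$5^2 - 9 * w$5^3" for w
    unfolding m_def det3_def dist_diff_plane_def
    by (simp_all add: power2_eq_square power3_eq_cube algebra_simps)
  consider "g = 3" "h = 0" | "g = 2" "h = 1" | "g = 1" "h = 2" | "g = 0" "h = 3"
    using assms by linarith
  then show ?thesis
  proof cases
    case 1
    show ?thesis
      by (rule hsop_multiples_cong[OF comb[of "9/16" "-1/16" "1/16" "-9/16"]])
         (simp add: 1 vals[unfolded One_nat_def] field_simps)
  next
    case 2
    show ?thesis
      by (rule hsop_multiples_cong[OF comb[of "-1/16" "-3/16" "-3/16" "-1/16"]])
         (simp add: 2 vals[unfolded One_nat_def] field_simps)
  next
    case 3
    show ?thesis
      by (rule hsop_multiples_cong[OF comb[of "1/16" "-1/16" "1/16" "-1/16"]])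
         (simp add: 3 vals[unfolded One_nat_def] field_simps)
  next
    case 4
    show ?thesis
      by (rule hsop_multiples_cong[OF comb[of "-1/16" "-1/48" "-1/48" "-1/16"]])
         (simp add: 4 vals[unfolded One_nat_def] field_simps)
  qed
qed

text \<open>Standard monomials \<open>h\<^sub>0\<^sup>a h\<^sub>1\<^sup>b h\<^sub>2\<^sup>c h\<^sub>3\<^sup>d X\<^sup>g Y\<^sup>h\<close>: those with \<open>g + h \<le> 2\<close> and total degree at most \<open>t\<close> turn out to
  restrict to a basis of the functions of degree at most \<open>t\<close> on the variety.\<close>

type_synonym std_exp = "nat \<times> nat \<times> nat \<times> nat \<times> nat \<times> nat"

definition std_mono :: "std_exp \<Rightarrow> complex ^ 6 \<Rightarrow> complex" where
  "std_mono = (\<lambda>(a, b, c, d, g, h) w.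
    hsop 0 w ^ a * hsop 1 w ^ b * hsop 2 w ^ c * hsop 3 w ^ d * (w $ 4 ^ g * w $ 5 ^ h))"

definition std_index :: "nat \<Rightarrow> std_exp set" where
  "std_index t = {(a, b, c, d, g, h). g + h \<le> 2 \<and> a + b + c + d + g + h \<le> t}"

definition std_span :: "nat \<Rightarrow> (complex ^ 6 \<Rightarrow> complex) set" where
  "std_span t = restrict_fun concyclic_variety -`
     fun_vs.span (restrict_fun concyclic_variety ` std_mono ` std_index t)"

lemma subspace_std_span: "fun_vs.subspace (std_span t)"
  unfolding std_span_def
  by (rule fun_vs_pair.linear_subspace_vimage[OF linear_restrict_fun fun_vs.subspace_span])

lemma std_span_add: "f \<in> std_span t \<Longrightarrow> g \<in> std_span t \<Longrightarrow> (\<lambda>w. f w + g w) \<in> std_span t"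
  using fun_vs.subspace_add[OF subspace_std_span] by (simp add: plus_fun_def)

lemma std_span_scale: "f \<in> std_span t \<Longrightarrow> (\<lambda>w. c * f w) \<in> std_span t"
  using fun_vs.subspace_scale[OF subspace_std_span] .

lemma std_span_diff: "f \<in> std_span t \<Longrightarrow> g \<in> std_span t \<Longrightarrow> (\<lambda>w. f w - g w) \<in> std_span t"
  using std_span_add[of f t "\<lambda>w. -1 * g w"] std_span_scale[of g t "-1"] by simp

lemma std_span_sum:
  "(\<And>i. i \<in> I \<Longrightarrow> f i \<in> std_span t) \<Longrightarrow> (\<lambda>w. \<Sum>i\<in>I. f i w) \<in> std_span t"
  using fun_vs.subspace_sum[OF subspace_std_span, of I f t] by (simp add: fun_sum_apply[abs_def])

lemma std_span_mono: "s \<le> t \<Longrightarrow> std_span s \<subseteq> std_span t"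
  unfolding std_span_def
  by (intro vimage_mono fun_vs.span_mono image_mono) (auto simp: std_index_def)

lemma std_span_cong:
  assumes "f \<in> std_span t" "\<And>w. w \<in> concyclic_variety \<Longrightarrow> f w = g w"
  shows "g \<in> std_span t"
proof -
  have "restrict_fun concyclic_variety g = restrict_fun concyclic_variety f"
    using assms(2) by (auto simp: restrict_fun_def fun_eq_iff)
  then show ?thesis using assms(1) by (simp add: std_span_def)
qed

lemma std_mono_in_std_span: "m \<in> std_index t \<Longrightarrow> std_mono m \<in> std_span t"
  unfolding std_span_def by (intro vimageI2 fun_vs.span_base imageI)

text \<open>Multiplication by a fixed function commutes with restriction to the variety and is linear, so it
  suffices to multiply the standard monomials.\<close>

lemma std_span_multiply:
  assumes step: "\<And>m. m \<in> std_index s \<Longrightarrow> (\<lambda>w. l w * std_mono m w) \<in> std_span t"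
    and f: "f \<in> std_span s"
  shows "(\<lambda>w. l w * f w) \<in> std_span t"
proof -
  let ?R = "restrict_fun concyclic_variety" and ?F = "\<lambda>h x. l x * h x"
  have R: "?R (?F h) = ?F (?R h)" for h by (auto simp: restrict_fun_def fun_eq_iff)
  have "?F ` ?R ` std_mono ` std_index s \<subseteq> fun_vs.span (?R ` std_mono ` std_index t)"
  proof clarify
    fix m assume "m \<in> std_index s"
    from step[OF this] show "?F (?R (std_mono m)) \<in> fun_vs.span (?R ` std_mono ` std_index t)"
      unfolding std_span_def vimage_eq R .
  qed
  then have sub: "fun_vs.span (?F ` ?R ` std_mono ` std_index s) \<subseteq> fun_vs.span (?R ` std_mono ` std_index t)"
    by (rule fun_vs.span_minimal[OF _ fun_vs.subspace_span])
  have "?R f \<in> fun_vs.span (?R ` std_mono ` std_index s)" using f unfolding std_span_def vimage_eq .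
  then have "?F (?R f) \<in> fun_vs.span (?F ` ?R ` std_mono ` std_index s)"
    unfolding fun_vs_pair.linear_span_image[OF linear_times_fun] by (rule imageI)
  then have "?R (?F f) \<in> fun_vs.span (?R ` std_mono ` std_index t)"
    unfolding R by (rule subsetD[OF sub])
  then show ?thesis unfolding std_span_def vimage_eq .
qed

lemma hsop_times_std_span:
  assumes "f \<in> std_span t" "k < 4"
  shows "(\<lambda>w. hsop k w * f w) \<in> std_span (Suc t)"
proof (rule std_span_multiply[OF _ assms(1)])
  fix m assume "m \<in> std_index t"
  then obtain a b c d g h where m: "m = (a, b, c, d, g, h)" "g + h \<le> 2" "a + b + c + d + g + h \<le> t"
    by (auto simp: std_index_def)
  consider "k = 0" | "k = 1" | "k = 2" | "k = 3" using assms(2) by linarith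
  then show "(\<lambda>w. hsop k w * std_mono m w) \<in> std_span (Suc t)"
  proof cases
    case 1
    show ?thesis
      by (rule std_span_cong[OF std_mono_in_std_span[of "(Suc a, b, c, d, g, h)"]])
         (use m in \<open>auto simp: 1 std_mono_def std_index_def\<close>)
  next
    case 2
    show ?thesis
      by (rule std_span_cong[OF std_mono_in_std_span[of "(a, Suc b, c, d, g, h)"]])
         (use m in \<open>auto simp: 2 std_mono_def std_index_def\<close>)
  next
    case 3
    show ?thesis
      by (rule std_span_cong[OF std_mono_in_std_span[of "(a, b, Suc c, d, g, h)"]])
         (use m in \<open>auto simp: 3 std_mono_def std_index_def\<close>)
  next
    case 4
    show ?thesis
      by (rule std_span_cong[OF std_mono_in_std_span[of "(a, b, c, Suc d, g, h)"]])
         (use m in \<open>auto simp: 4 std_mono_def std_index_def\<close>)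
  qed
qed

lemma hsop_power_times_std_span:
  "f \<in> std_span t \<Longrightarrow> k < 4 \<Longrightarrow> (\<lambda>w. hsop k w ^ n * f w) \<in> std_span (t + n)"
proof (induction n)
  case (Suc n)
  then show ?case using hsop_times_std_span[of "\<lambda>w. hsop k w ^ n * f w" "t + n" k]
    by (simp add: mult.assoc)
qed simp

text \<open>Every coordinate is a linear combination of the \<open>h\<^sub>k\<close> and of the coordinates \<open>4\<close> and \<open>5\<close>.\<close>

lemma coord_times_std_span:
  assumes "f \<in> std_span t"
    and "(\<lambda>w. w $ 4 * f w) \<in> std_span (Suc t)" "(\<lambda>w. w $ 5 * f w) \<in> std_span (Suc t)"
  shows "(\<lambda>w. w $ i * f w) \<in> std_span (Suc t)"
proof -
  have H: "(\<lambda>w. hsop k w * f w) \<in> std_span (Suc t)" if "k < 4" for k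
    by (rule hsop_times_std_span[OF assms(1) that])
  have "(\<lambda>w. w $ 1 * f w) \<in> std_span (Suc t)"
    by (rule std_span_cong[OF std_span_diff[OF H[of 1] assms(2)]]) (simp_all add: hsop_simps algebra_simps)
  moreover have "(\<lambda>w. w $ 2 * f w) \<in> std_span (Suc t)"
    by (rule std_span_cong[OF std_span_diff[OF H[of 2] assms(3)]]) (simp_all add: hsop_simps algebra_simps)
  moreover have 6: "(\<lambda>w. w $ 6 * f w) \<in> std_span (Suc t)"
    by (rule std_span_cong[OF std_span_diff[OF H[of 0] std_span_scale[OF assms(3), of 2]]])
       (simp_all add: hsop_simps algebra_simps)
  moreover have "(\<lambda>w. w $ 3 * f w) \<in> std_span (Suc t)"
    by (rule std_span_cong[OF std_span_diff[OF H[of 3] 6]]) (simp_all add: hsop_simps algebra_simps)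
  ultimately show ?thesis using assms(2,3) exhaust_6[of i] by auto
qed

lemma std_span_one: "(\<lambda>w. 1) \<in> std_span t"
  by (rule std_span_cong[OF std_mono_in_std_span[of "(0, 0, 0, 0, 0, 0)"]])
     (auto simp: std_index_def std_mono_def)

text \<open>Up to degree two the bound \<open>g + h \<le> 2\<close> is automatic, so multiplication by \<open>X\<close> and \<open>Y\<close> stays
  among the standard monomials.  This case covers the cofactors in \<open>hsop_multiples\<close>.\<close>

lemma poly_funs_le_2_subset_std_span: "poly_funs_le 2 \<subseteq> std_span 2"
proof (rule poly_funs_le_subset_filtration[where u = 2])
  fix t i and f :: "complex ^ 6 \<Rightarrow> complex" assume t: "Suc t \<le> 2" and f: "f \<in> std_span t"
  have z4: "(\<lambda>w. w $ 4 * f w) \<in> std_span (Suc t)"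
  proof (rule std_span_multiply[OF _ f], clarify)
    fix a b c d g h assume "(a, b, c, d, g, h) \<in> std_index t"
    then show "(\<lambda>w. w $ 4 * std_mono (a, b, c, d, g, h) w) \<in> std_span (Suc t)"
      by (intro std_span_cong[OF std_mono_in_std_span[of "(a, b, c, d, Suc g, h)"]])
         (use t in \<open>auto simp: std_index_def std_mono_def\<close>)
  qed
  have z5: "(\<lambda>w. w $ 5 * f w) \<in> std_span (Suc t)"
  proof (rule std_span_multiply[OF _ f], clarify)
    fix a b c d g h assume "(a, b, c, d, g, h) \<in> std_index t"
    then show "(\<lambda>w. w $ 5 * std_mono (a, b, c, d, g, h) w) \<in> std_span (Suc t)"
      by (intro std_span_cong[OF std_mono_in_std_span[of "(a, b, c, d, g, Suc h)"]])
         (use t in \<open>auto simp: std_index_def std_mono_def\<close>)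
  qed
  show "(\<lambda>w. w $ i * f w) \<in> std_span (Suc t)" by (rule coord_times_std_span[OF f z4 z5])
qed (rule subspace_std_span std_span_one std_span_mono order_refl le_SucI)+

lemma hsop_multiples_subset_std_span:
  assumes "f \<in> hsop_multiples"
  shows "f \<in> std_span 3"
proof -
  obtain q where q: "\<And>k. k < 4 \<Longrightarrow> q k \<in> poly_funs_le 2"
    "\<And>w. w \<in> concyclic_variety \<Longrightarrow> f w = (\<Sum>k<4. hsop k w * q k w)"
    using assms unfolding hsop_multiples_def by blast
  have "(\<lambda>w. hsop k w * q k w) \<in> std_span 3" if "k < 4" for k
    using hsop_times_std_span[OF subsetD[OF poly_funs_le_2_subset_std_span q(1)[OF that]] that]
    by (simp add: eval_nat_numeral)
  then have "(\<lambda>w. \<Sum>k<4. hsop k w * q k w) \<in> std_span 3" by (intro std_span_sum) simp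
  then show ?thesis by (rule std_span_cong) (simp add: q(2))
qed

text \<open>When multiplication by \<open>X\<close> or \<open>Y\<close> leaves the standard range, a binary cubic appears, which the
  minors rewrite in the ideal of the \<open>h\<^sub>k\<close>.\<close>

lemma std_mono_overflow:
  assumes "g + h = 3" "a + b + c + d + 3 \<le> t"
  shows "std_mono (a, b, c, d, g, h) \<in> std_span t"
proof -
  have "(\<lambda>w. hsop 0 w ^ a * (hsop 1 w ^ b * (hsop 2 w ^ c * (hsop 3 w ^ d * (w $ 4 ^ g * w $ 5 ^ h)))))
      \<in> std_span (3 + d + c + b + a)"
    by (intro hsop_power_times_std_span hsop_multiples_subset_std_span
        cubic_in_hsop_multiples assms(1)) auto
  also have "\<dots> \<subseteq> std_span t" using assms(2) by (intro std_span_mono) simp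
  finally show ?thesis by (simp add: std_mono_def mult.assoc)
qed

lemma std_mono_extended:
  assumes "g + h \<le> 3" "a + b + c + d + g + h \<le> t"
  shows "std_mono (a, b, c, d, g, h) \<in> std_span t"
proof (cases "g + h = 3")
  case True
  then show ?thesis using assms by (intro std_mono_overflow) auto
next
  case False
  then show ?thesis using assms by (intro std_mono_in_std_span) (auto simp: std_index_def)
qed

lemma poly_funs_le_subset_std_span: "poly_funs_le t \<subseteq> std_span t"
proof (rule poly_funs_le_subset_filtration[OF _ _ _ _ order_refl])
  fix t i and f :: "complex ^ 6 \<Rightarrow> complex" assume f: "f \<in> std_span t"
  have z4: "(\<lambda>w. w $ 4 * f w) \<in> std_span (Suc t)"
  proof (rule std_span_multiply[OF _ f], clarify)
    fix a b c d g h assume "(a, b, c, d, g, h) \<in> std_index t"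
    then show "(\<lambda>w. w $ 4 * std_mono (a, b, c, d, g, h) w) \<in> std_span (Suc t)"
      by (intro std_span_cong[OF std_mono_extended[of "Suc g" h a b c d]])
         (auto simp: std_index_def std_mono_def)
  qed
  have z5: "(\<lambda>w. w $ 5 * f w) \<in> std_span (Suc t)"
  proof (rule std_span_multiply[OF _ f], clarify)
    fix a b c d g h assume "(a, b, c, d, g, h) \<in> std_index t"
    then show "(\<lambda>w. w $ 5 * std_mono (a, b, c, d, g, h) w) \<in> std_span (Suc t)"
      by (intro std_span_cong[OF std_mono_extended[of g "Suc h" a b c d]])
         (auto simp: std_index_def std_mono_def)
  qed
  show "(\<lambda>w. w $ i * f w) \<in> std_span (Suc t)" by (rule coord_times_std_span[OF f z4 z5])
qed (rule subspace_std_span std_span_one std_span_mono order_refl le_SucI)+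

lemma std_mono_poly:
  assumes "m \<in> std_index t"
  shows "std_mono m \<in> poly_funs_le t"
proof -
  obtain a b c d g h where m: "m = (a, b, c, d, g, h)" "a + b + c + d + g + h \<le> t"
    using assms by (auto simp: std_index_def)
  have pow: "(\<lambda>w. f w ^ n) \<in> poly_funs_le n" if "f \<in> poly_funs_le 1" for f n
  proof (induction n)
    case (Suc n)
    show ?case using poly_funs_le_mult[OF that Suc] by simp
  qed (simp add: poly_funs_le_const)
  have co: "(\<lambda>w. w $ i) \<in> poly_funs_le 1" for i :: 6 by (rule poly_funs_le_coord) simp
  have h: "hsop 0 \<in> poly_funs_le 1" "hsop 1 \<in> poly_funs_le 1" "hsop 2 \<in> poly_funs_le 1"
    "hsop 3 \<in> poly_funs_le 1"
    by (intro hsop_poly; simp)+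
  have "std_mono m \<in> poly_funs_le (a + b + c + d + (g + h))"
    unfolding m std_mono_def prod.case by (intro poly_funs_le_mult pow h co)
  then show ?thesis using poly_funs_le_mono m(2) by (metis add.assoc subsetD)
qed

section \<open>Six points in every nearby fibre\<close>

type_synonym cvec4 = "complex \<times> complex \<times> complex \<times> complex"

text \<open>Substituting \<open>y = e p\<close>, \<open>z = e q\<close>, \<open>s = 1 / e\<close> in \<open>concyclic_dist\<close> gives expressions that stay
  polynomial at \<open>e = 0\<close>.  There the two opposite distances \<open>A\<close> and \<open>X\<close> vanish, while the other
  four have the limits \<open>x\<^sup>2 p, x q, x\<^sup>2 q, x p\<close>.  The six entries are \<open>A, X, B, Y, C, Z\<close> in this order;
  permuting the parameters yields two more charts, in which another pair of opposite distances
  vanishes at \<open>e = 0\<close>.\<close>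

definition limit_chart :: "nat \<Rightarrow> cvec4 \<Rightarrow> complex" where
  "limit_chart k = (\<lambda>(e, x, p, q).
    [e * (p - q)\<^sup>2 * x, e * (x - 1)\<^sup>2 * (p * q), (x - e * q)\<^sup>2 * p, (e * p - 1)\<^sup>2 * (x * q),
     (x - e * p)\<^sup>2 * q, (e * q - 1)\<^sup>2 * (x * p)] ! k)"

lemma limit_chart_simps:
  "limit_chart 0 (e, x, p, q) = e * (p - q)\<^sup>2 * x"
  "limit_chart 1 (e, x, p, q) = e * (x - 1)\<^sup>2 * (p * q)"
  "limit_chart 2 (e, x, p, q) = (x - e * q)\<^sup>2 * p"
  "limit_chart 3 (e, x, p, q) = (e * p - 1)\<^sup>2 * (x * q)"
  "limit_chart 4 (e, x, p, q) = (x - e * p)\<^sup>2 * q"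
  "limit_chart 5 (e, x, p, q) = (e * q - 1)\<^sup>2 * (x * p)"
  by (simp_all add: limit_chart_def)

text \<open>For \<open>e \<noteq> 0\<close> the charts are in the image of \<open>concyclic_dist\<close>, and a closed set that contains a
  polynomial curve outside one parameter contains all of it.\<close>

lemma limit_charts_in_variety:
  "vector [limit_chart 0 u, limit_chart 2 u, limit_chart 4 u,
           limit_chart 1 u, limit_chart 3 u, limit_chart 5 u] \<in> concyclic_variety" (is "?A u \<in> _")
  "vector [limit_chart 2 u, limit_chart 0 u, limit_chart 4 u,
           limit_chart 3 u, limit_chart 1 u, limit_chart 5 u] \<in> concyclic_variety" (is "?B u \<in> _")
  "vector [limit_chart 2 u, limit_chart 4 u, limit_chart 0 u,
           limit_chart 3 u, limit_chart 5 u, limit_chart 1 u] \<in> concyclic_variety" (is "?C u \<in> _")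
proof -
  obtain e x p q where u: "u = (e, x, p, q)" by (cases u) auto
  have limit: "F (e, x, p, q) \<in> concyclic_variety"
    if "\<forall>i. \<exists>P. \<forall>t. F (t, x, p, q) $ i = poly P t"
      and "\<And>t. t \<noteq> 0 \<Longrightarrow> F (t, x, p, q) \<in> concyclic_variety" for F :: "cvec4 \<Rightarrow> complex ^ 6"
    unfolding concyclic_variety_def
    by (rule zariski_closure_curve[where F = "{0}" and \<gamma> = "\<lambda>t. F (t, x, p, q)"])
       (use that in \<open>auto simp: concyclic_variety_def\<close>)
  show "?A u \<in> concyclic_variety" unfolding u
  proof (rule limit[of ?A])
    show "\<forall>i. \<exists>P. \<forall>t. ?A (t, x, p, q) $ i = poly P t"
      unfolding forall_6 vector_6 limit_chart_simps by (intro conjI poly_curve_intros)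
    fix t :: complex assume "t \<noteq> 0"
    then have "?A (t, x, p, q) = concyclic_dist (1 / t) x (t * p) (t * q)"
      unfolding concyclic_dist_def limit_chart_simps vec_eq_iff forall_6 vector_6
      by (simp add: field_simps power2_eq_square)
    then show "?A (t, x, p, q) \<in> concyclic_variety" by (simp add: concyclic_dist_in_variety)
  qed
  show "?B u \<in> concyclic_variety" unfolding u
  proof (rule limit[of ?B])
    show "\<forall>i. \<exists>P. \<forall>t. ?B (t, x, p, q) $ i = poly P t"
      unfolding forall_6 vector_6 limit_chart_simps by (intro conjI poly_curve_intros)
    fix t :: complex assume "t \<noteq> 0"
    then have "?B (t, x, p, q) = concyclic_dist (1 / t) (t * p) x (t * q)"
      unfolding concyclic_dist_def limit_chart_simps vec_eq_iff forall_6 vector_6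
      by (simp add: field_simps power2_eq_square)
    then show "?B (t, x, p, q) \<in> concyclic_variety" by (simp add: concyclic_dist_in_variety)
  qed
  show "?C u \<in> concyclic_variety" unfolding u
  proof (rule limit[of ?C])
    show "\<forall>i. \<exists>P. \<forall>t. ?C (t, x, p, q) $ i = poly P t"
      unfolding forall_6 vector_6 limit_chart_simps by (intro conjI poly_curve_intros)
    fix t :: complex assume "t \<noteq> 0"
    then have "?C (t, x, p, q) = concyclic_dist (1 / t) (t * p) (t * q) x"
      unfolding concyclic_dist_def limit_chart_simps vec_eq_iff forall_6 vector_6
      by (simp add: field_simps power2_eq_square)
    then show "?C (t, x, p, q) \<in> concyclic_variety" by (simp add: concyclic_dist_in_variety)
  qed
qed

text \<open>The values of the \<open>h\<^sub>k\<close> in a chart, up to the order of the last three.  The coefficients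
  \<open>k, l, m\<close> depend on the chart because \<open>h\<^sub>0 = 2 Y + Z\<close> is not invariant under permutations.\<close>

definition chart_params :: "complex \<Rightarrow> complex \<Rightarrow> complex \<Rightarrow> cvec4 \<Rightarrow> cvec4" where
  "chart_params k l m u = (k * limit_chart 1 u + l * limit_chart 3 u + m * limit_chart 5 u,
    limit_chart 0 u + limit_chart 1 u, limit_chart 2 u + limit_chart 3 u,
    limit_chart 4 u + limit_chart 5 u)"

text \<open>The two signs \<open>\<sigma> = 1\<close> and \<open>\<sigma> = -1\<close> are the two vertices that a chart reaches: at the base
  point the entries \<open>2, 3, 4, 5\<close> are \<open>-h, h, \<sigma> h, -\<sigma> h\<close>, so the last three of the parameters
  vanish.\<close>

lemma chart_params_derivative:
  assumes "\<sigma>\<^sup>2 = 1"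
  shows "(chart_params k l m has_derivative
    (\<lambda>(e, x, p, q). (k * (2 * h\<^sup>2 * (1 - \<sigma>) * e) + l * (2 * h\<^sup>2 * e + \<sigma> * h * x + \<sigma> * q)
        + m * (2 * h\<^sup>2 * e - h * x + \<sigma> * p),
      4 * h\<^sup>2 * e,
      4 * h\<^sup>2 * e - \<sigma> * h * x + p + \<sigma> * q,
      4 * h\<^sup>2 * e + h * x + q + \<sigma> * p))) (at (0, \<sigma>, - h, \<sigma> * h))"
proof -
  have ss: "\<sigma> * (\<sigma> * a) = a" for a
    using assms by (simp add: power2_eq_square mult.assoc[symmetric])
  have "(chart_params k l m has_derivative
    (\<lambda>u. (k * ((\<sigma> - 1)\<^sup>2 * (- h * (\<sigma> * h)) * fst u)
        + l * (- 2 * (- h) * (\<sigma> * (\<sigma> * h)) * fst u + (\<sigma> * h) * fst (snd u) + \<sigma> * snd (snd (snd u)))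
        + m * (- 2 * (\<sigma> * h) * (\<sigma> * (- h)) * fst u + (- h) * fst (snd u) + \<sigma> * fst (snd (snd u))),
      (- h - \<sigma> * h)\<^sup>2 * \<sigma> * fst u + (\<sigma> - 1)\<^sup>2 * (- h * (\<sigma> * h)) * fst u,
      (- 2 * \<sigma> * (\<sigma> * h) * (- h) * fst u + 2 * \<sigma> * (- h) * fst (snd u) + \<sigma>\<^sup>2 * fst (snd (snd u)))
        + (- 2 * (- h) * (\<sigma> * (\<sigma> * h)) * fst u + (\<sigma> * h) * fst (snd u) + \<sigma> * snd (snd (snd u))),
      (- 2 * \<sigma> * (- h) * (\<sigma> * h) * fst u + 2 * \<sigma> * (\<sigma> * h) * fst (snd u) + \<sigma>\<^sup>2 * snd (snd (snd u)))
        + (- 2 * (\<sigma> * h) * (\<sigma> * (- h)) * fst u + (- h) * fst (snd u) + \<sigma> * fst (snd (snd u))))))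
    (at (0, \<sigma>, - h, \<sigma> * h))"
    unfolding chart_params_def[abs_def] limit_chart_def case_prod_unfold
    by (auto intro!: derivative_eq_intros simp: fun_eq_iff algebra_simps power2_eq_square)
  then show ?thesis
    by (rule has_derivative_eq_rhs)
       (auto simp: fun_eq_iff case_prod_unfold algebra_simps power2_eq_square ss)
qed

text \<open>The derivative at the base point is invertible, the map \<open>?g\<close> of the proof being its inverse,
  obtained by solving the last three equations for \<open>e\<close>, \<open>x\<close> and \<open>p + \<sigma> q\<close> first.\<close>

lemma chart_params_open:
  assumes \<sigma>: "\<sigma>\<^sup>2 = 1" and "h \<noteq> 0" and "\<sigma> * l \<noteq> m" and T: "open T" "(0, \<sigma>, - h, \<sigma> * h) \<in> T"
  shows "chart_params k l m (0, \<sigma>, - h, \<sigma> * h) \<in> interior (chart_params k l m ` T)"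
proof -
  have ss: "\<sigma> * (\<sigma> * a) = a" for a
    using \<sigma> by (simp add: power2_eq_square mult.assoc[symmetric])
  have "\<sigma> \<noteq> 0" using \<sigma> by auto
  let ?x = "\<lambda>b c d. (\<sigma> * d - c - (\<sigma> - 1) * b) / (2 * \<sigma> * h)"
  let ?S = "\<lambda>b c d. (c + \<sigma> * d - (1 + \<sigma>) * b) / 2"
  let ?q = "\<lambda>a b c d. (a - k * (1 - \<sigma>) * b / 2 - l * (b / 2 + \<sigma> * h * ?x b c d)
      - m * (b / 2 - h * ?x b c d + \<sigma> * ?S b c d)) / (\<sigma> * l - m)"
  let ?g = "\<lambda>(a, b, c, d). (b / (4 * h\<^sup>2), ?x b c d, ?S b c d - \<sigma> * ?q a b c d, ?q a b c d)"
  let ?f' = "\<lambda>(e, x, p, q). (k * (2 * h\<^sup>2 * (1 - \<sigma>) * e) + l * (2 * h\<^sup>2 * e + \<sigma> * h * x + \<sigma> * q)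
        + m * (2 * h\<^sup>2 * e - h * x + \<sigma> * p),
      4 * h\<^sup>2 * e, 4 * h\<^sup>2 * e - \<sigma> * h * x + p + \<sigma> * q, 4 * h\<^sup>2 * e + h * x + q + \<sigma> * p)"
  show ?thesis
  proof (rule sussmann_open_mapping[OF open_UNIV _ UNIV_I chart_params_derivative[OF \<sigma>]])
    show "continuous_on UNIV (chart_params k l m)"
      unfolding chart_params_def[abs_def] limit_chart_def case_prod_unfold
      by (simp, intro continuous_intros)
    show "bounded_linear ?g"
      unfolding case_prod_unfold divide_inverse
      by (intro bounded_linear_intros)
    show "?f' \<circ> ?g = id"
    proof (rule ext, clarify)
      fix a b c d :: complex
      define e x S q where "e = b / (4 * h\<^sup>2)" and "x = ?x b c d" and "S = ?S b c d" and "q = ?q a b c d"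
      have x: "2 * (h * x) = d - \<sigma> * c - (1 - \<sigma>) * b"
        using \<open>h \<noteq> 0\<close> \<open>\<sigma> \<noteq> 0\<close> by (simp add: x_def field_simps ss)
      have e: "4 * (h\<^sup>2 * e) = b" using \<open>h \<noteq> 0\<close> by (simp add: e_def)
      have S: "2 * S = c + \<sigma> * d - (1 + \<sigma>) * b" by (simp add: S_def)
      have "(\<sigma> * l - m) * q = a - k * (1 - \<sigma>) * b / 2 - l * (b / 2 + \<sigma> * h * x)
          - m * (b / 2 - h * x + \<sigma> * S)"
        using assms(3) by (simp add: q_def x_def S_def)
      then have q: "2 * ((\<sigma> * l - m) * q) = 2 * a - k * (1 - \<sigma>) * b - l * (b + 2 * \<sigma> * (h * x))
          - m * (b - 2 * (h * x) + 2 * \<sigma> * S)"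
        by (simp only:) (simp add: field_simps)
      have "?g (a, b, c, d) = (e, x, S - \<sigma> * q, q)"
        by (simp add: e_def x_def S_def q_def)
      moreover have "k * (2 * h\<^sup>2 * (1 - \<sigma>) * e) + l * (2 * h\<^sup>2 * e + \<sigma> * h * x + \<sigma> * q)
          + m * (2 * h\<^sup>2 * e - h * x + \<sigma> * (S - \<sigma> * q)) = a" (is "?l = a")
      proof -
        have "2 * ?l = k * (1 - \<sigma>) * (4 * (h\<^sup>2 * e)) + l * (4 * (h\<^sup>2 * e) + 2 * \<sigma> * (h * x))
            + m * (4 * (h\<^sup>2 * e) - 2 * (h * x) + 2 * \<sigma> * S) + 2 * ((\<sigma> * l - m) * q)"
          by (simp add: algebra_simps ss)
        also have "\<dots> = 2 * a" unfolding e q by (simp add: algebra_simps)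
        finally show ?thesis by (rule iffD1[OF mult_left_cancel, rotated]) simp
      qed
      moreover have "4 * h\<^sup>2 * e - \<sigma> * h * x + (S - \<sigma> * q) + \<sigma> * q = c" (is "?l = c")
      proof -
        have "2 * ?l = 2 * (4 * (h\<^sup>2 * e)) - \<sigma> * (2 * (h * x)) + 2 * S"
          by (simp add: algebra_simps)
        also have "\<dots> = 2 * c" unfolding e x S by (simp add: algebra_simps ss)
        finally show ?thesis by (rule iffD1[OF mult_left_cancel, rotated]) simp
      qed
      moreover have "4 * h\<^sup>2 * e + h * x + q + \<sigma> * (S - \<sigma> * q) = d" (is "?l = d")
      proof -
        have "2 * ?l = 2 * (4 * (h\<^sup>2 * e)) + 2 * (h * x) + \<sigma> * (2 * S)"
          by (simp add: algebra_simps ss)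
        also have "\<dots> = 2 * d" unfolding e x S by (simp add: algebra_simps ss)
        finally show ?thesis by (rule iffD1[OF mult_left_cancel, rotated]) simp
      qed
      moreover have "4 * h\<^sup>2 * e = b" using e by (simp add: mult.assoc)
      ultimately show "(?f' \<circ> ?g) (a, b, c, d) = id (a, b, c, d)"
        by (simp only: o_apply id_apply prod.case)
    qed
  qed (use T in \<open>auto simp: interior_open\<close>)
qed

text \<open>The condition on \<open>h\<close> normalises the first parameter to \<open>1\<close>.\<close>

lemma chart_params_fibre:
  assumes \<sigma>: "\<sigma>\<^sup>2 = 1" and h: "h * (l - \<sigma> * m) = 1" and "\<epsilon> > 0"
  shows "\<exists>\<delta>>0. \<forall>y\<in>ball (1, 0, 0, 0) \<delta>. \<exists>u. chart_params k l m u = y \<and>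
    dist (limit_chart 1 u) 0 < \<epsilon> \<and> dist (limit_chart 3 u) h < \<epsilon> \<and> dist (limit_chart 5 u) (- \<sigma> * h) < \<epsilon>"
proof -
  have ss: "\<sigma> * (\<sigma> * a) = a" for a
    using \<sigma> by (simp add: power2_eq_square mult.assoc[symmetric])
  let ?u = "(0, \<sigma>, - h, \<sigma> * h)"
  let ?T = "{u. dist (limit_chart 1 u) 0 < \<epsilon>} \<inter> {u. dist (limit_chart 3 u) h < \<epsilon>}
    \<inter> {u. dist (limit_chart 5 u) (- \<sigma> * h) < \<epsilon>}"
  have "continuous_on UNIV (limit_chart k)" if "k \<in> {1, 3, 5}" for k
    using that unfolding limit_chart_def case_prod_unfold
    by (elim insertE emptyE; simp; intro continuous_intros)
  then have "open ?T" by (intro open_Int open_Collect_less continuous_intros) auto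
  moreover have "?u \<in> ?T" using \<open>\<epsilon> > 0\<close> by (simp add: limit_chart_def ss)
  moreover have "h \<noteq> 0" using h by auto
  moreover have "\<sigma> * l \<noteq> m"
  proof
    assume "\<sigma> * l = m"
    then have "l - \<sigma> * m = 0" using ss[of l] by simp
    then show False using h by simp
  qed
  ultimately have "chart_params k l m ?u \<in> interior (chart_params k l m ` ?T)"
    by (intro chart_params_open[OF \<sigma>])
  moreover have "chart_params k l m ?u = (h * (l - \<sigma> * m), 0, 0, 0)"
    unfolding chart_params_def limit_chart_simps prod.inject
    using \<sigma> by (intro conjI) (simp_all add: right_diff_distrib ss)
  ultimately have "(1, 0, 0, 0) \<in> interior (chart_params k l m ` ?T)" by (simp only: h)
  then obtain \<delta> where \<delta>: "\<delta> > 0" "ball (1, 0, 0, 0) \<delta> \<subseteq> chart_params k l m ` ?T"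
    unfolding mem_interior by blast
  show ?thesis
  proof (intro exI[of _ \<delta>] conjI ballI)
    fix y :: cvec4 assume "y \<in> ball (1, 0, 0, 0) \<delta>"
    then obtain u where "u \<in> ?T" "y = chart_params k l m u" using \<delta>(2) by blast
    then show "\<exists>u. chart_params k l m u = y \<and> dist (limit_chart 1 u) 0 < \<epsilon> \<and>
        dist (limit_chart 3 u) h < \<epsilon> \<and> dist (limit_chart 5 u) (- \<sigma> * h) < \<epsilon>"
      by blast
  qed (rule \<delta>(1))
qed

definition hsop_vec :: "complex ^ 6 \<Rightarrow> cvec4" where
  "hsop_vec w = (hsop 0 w, hsop 1 w, hsop 2 w, hsop 3 w)"

text \<open>Coordinates \<open>(X, Y)\<close> of a point of the fibre over \<open>(1, 0, 0, 0)\<close> that persists in the fibres over all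
  nearby values of the \<open>h\<^sub>k\<close>.\<close>

definition stable_fibre_point :: "complex \<Rightarrow> complex \<Rightarrow> bool" where
  "stable_fibre_point a b \<longleftrightarrow> (\<forall>\<epsilon>>0. \<exists>\<delta>>0. \<forall>y\<in>ball (1, 0, 0, 0) \<delta>. \<exists>w\<in>concyclic_variety.
    hsop_vec w = y \<and> dist (w $ 4) a < \<epsilon> \<and> dist (w $ 5) b < \<epsilon>)"

lemma stable_fibre_points_AX:
  assumes "\<sigma>\<^sup>2 = 1" "h * (2 - \<sigma> * 1) = 1"
  shows "stable_fibre_point 0 h"
  unfolding stable_fibre_point_def
proof (intro allI impI)
  fix \<epsilon> :: real assume "\<epsilon> > 0"
  obtain \<delta> where \<delta>: "\<delta> > 0" "\<forall>y\<in>ball (1, 0, 0, 0) \<delta>. \<exists>u. chart_params 0 2 1 u = y \<and>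
    dist (limit_chart 1 u) 0 < \<epsilon> \<and> dist (limit_chart 3 u) h < \<epsilon> \<and> dist (limit_chart 5 u) (- \<sigma> * h) < \<epsilon>"
    using chart_params_fibre[OF assms \<open>\<epsilon> > 0\<close>, of 0] by blast
  have *: "\<exists>w\<in>concyclic_variety. hsop_vec w = y \<and> dist (w $ 4) 0 < \<epsilon> \<and> dist (w $ 5) h < \<epsilon>"
    if ball: "y \<in> ball (1, 0, 0, 0) \<delta>" for y :: cvec4
  proof -
    obtain u where u: "chart_params 0 2 1 u = y" "dist (limit_chart 1 u) 0 < \<epsilon>" "dist (limit_chart 3 u) h < \<epsilon>"
      using bspec[OF \<delta>(2) ball] by (elim exE conjE)
    show ?thesis
      by (rule bexI[OF _ limit_charts_in_variety(1)[of u]])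
         (use u in \<open>simp add: hsop_vec_def hsop_simps chart_params_def\<close>)
  qed
  show "\<exists>\<delta>>0. \<forall>y\<in>ball (1, 0, 0, 0) \<delta>. \<exists>w\<in>concyclic_variety.
    hsop_vec w = y \<and> dist (w $ 4) 0 < \<epsilon> \<and> dist (w $ 5) h < \<epsilon>"
    by (rule exI[of _ \<delta>], rule conjI[OF \<delta>(1)], rule ballI, rule *)
qed

lemma stable_fibre_points_BY:
  assumes "\<sigma>\<^sup>2 = 1" "h * (0 - \<sigma> * 1) = 1"
  shows "stable_fibre_point h 0"
  unfolding stable_fibre_point_def
proof (intro allI impI)
  fix \<epsilon> :: real assume "\<epsilon> > 0"
  obtain \<delta> where \<delta>: "\<delta> > 0" "\<forall>y\<in>ball (1, 0, 0, 0) \<delta>. \<exists>u. chart_params 2 0 1 u = y \<and>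
    dist (limit_chart 1 u) 0 < \<epsilon> \<and> dist (limit_chart 3 u) h < \<epsilon> \<and> dist (limit_chart 5 u) (- \<sigma> * h) < \<epsilon>"
    using chart_params_fibre[OF assms \<open>\<epsilon> > 0\<close>, of 2] by blast
  have *: "\<exists>w\<in>concyclic_variety. hsop_vec w = y \<and> dist (w $ 4) h < \<epsilon> \<and> dist (w $ 5) 0 < \<epsilon>"
    if ball: "y \<in> ball (1, 0, 0, 0) \<delta>" for y :: cvec4
  proof -
    (* This chart lists the last three parameters in another order. *)
    obtain a b c d where y: "y = (a, b, c, d)" by (cases y) auto
    then have "(a, c, b, d) \<in> ball (1, 0, 0, 0) \<delta>"
      using ball by (simp add: dist_prod_def add_ac)
    from bspec[OF \<delta>(2) this] obtain u where u: "chart_params 2 0 1 u = (a, c, b, d)" "dist (limit_chart 1 u) 0 < \<epsilon>" "dist (limit_chart 3 u) h < \<epsilon>"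
      by (elim exE conjE)
    show ?thesis
      by (rule bexI[OF _ limit_charts_in_variety(2)[of u]])
         (use u in \<open>simp add: hsop_vec_def hsop_simps chart_params_def y\<close>)
  qed
  show "\<exists>\<delta>>0. \<forall>y\<in>ball (1, 0, 0, 0) \<delta>. \<exists>w\<in>concyclic_variety.
    hsop_vec w = y \<and> dist (w $ 4) h < \<epsilon> \<and> dist (w $ 5) 0 < \<epsilon>"
    by (rule exI[of _ \<delta>], rule conjI[OF \<delta>(1)], rule ballI, rule *)
qed

lemma stable_fibre_points_CZ:
  assumes "\<sigma>\<^sup>2 = 1" "h * (0 - \<sigma> * 2) = 1"
  shows "stable_fibre_point h (- \<sigma> * h)"
  unfolding stable_fibre_point_def
proof (intro allI impI)
  fix \<epsilon> :: real assume "\<epsilon> > 0"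
  obtain \<delta> where \<delta>: "\<delta> > 0" "\<forall>y\<in>ball (1, 0, 0, 0) \<delta>. \<exists>u. chart_params 1 0 2 u = y \<and>
    dist (limit_chart 1 u) 0 < \<epsilon> \<and> dist (limit_chart 3 u) h < \<epsilon> \<and> dist (limit_chart 5 u) (- \<sigma> * h) < \<epsilon>"
    using chart_params_fibre[OF assms \<open>\<epsilon> > 0\<close>, of 1] by blast
  have *: "\<exists>w\<in>concyclic_variety. hsop_vec w = y \<and> dist (w $ 4) h < \<epsilon> \<and> dist (w $ 5) (- \<sigma> * h) < \<epsilon>"
    if ball: "y \<in> ball (1, 0, 0, 0) \<delta>" for y :: cvec4
  proof -
    (* This chart lists the last three parameters in another order. *)
    obtain a b c d where y: "y = (a, b, c, d)" by (cases y) auto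
    then have "(a, d, b, c) \<in> ball (1, 0, 0, 0) \<delta>"
      using ball by (simp add: dist_prod_def add_ac)
    from bspec[OF \<delta>(2) this] obtain u where u: "chart_params 1 0 2 u = (a, d, b, c)" "dist (limit_chart 3 u) h < \<epsilon>"
      "dist (limit_chart 5 u) (- \<sigma> * h) < \<epsilon>"
      by (elim exE conjE)
    show ?thesis
      by (rule bexI[OF _ limit_charts_in_variety(3)[of u]])
         (use u in \<open>simp add: hsop_vec_def hsop_simps chart_params_def y add.commute\<close>)
  qed
  show "\<exists>\<delta>>0. \<forall>y\<in>ball (1, 0, 0, 0) \<delta>. \<exists>w\<in>concyclic_variety.
    hsop_vec w = y \<and> dist (w $ 4) h < \<epsilon> \<and> dist (w $ 5) (- \<sigma> * h) < \<epsilon>"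
    by (rule exI[of _ \<delta>], rule conjI[OF \<delta>(1)], rule ballI, rule *)
qed

section \<open>Linear independence of the standard monomials\<close>

text \<open>The six vertices of the complete quadrilateral with sides \<open>X \<plusminus> Y \<plusminus> Z = 0\<close>, in the affine chart
  \<open>2 Y + Z = 1\<close> with coordinates \<open>(X, Y)\<close>.\<close>

definition fibre_x :: "complex ^ 6" where "fibre_x = vector [0, 0, -1, 1, -1/2, 1/2]"
definition fibre_y :: "complex ^ 6" where "fibre_y = vector [1, 1/3, 0, 0, 1/2, 1/2]"

lemma stable_fibre_points: "stable_fibre_point (fibre_x $ k) (fibre_y $ k)"
proof -
  have "\<forall>k. stable_fibre_point (fibre_x $ k) (fibre_y $ k)"
    unfolding forall_6 fibre_x_def fibre_y_def vector_6
    using stable_fibre_points_AX[of 1 1] stable_fibre_points_AX[of "-1" "1/3"]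
      stable_fibre_points_BY[of 1 "-1"] stable_fibre_points_BY[of "-1" 1]
      stable_fibre_points_CZ[of 1 "-1/2"] stable_fibre_points_CZ[of "-1" "1/2"] by simp
  then show ?thesis ..
qed

text \<open>Exponents of the monomials of degree at most two in \<open>X\<close> and \<open>Y\<close>.\<close>

definition conic_exp_x :: "nat ^ 6" where "conic_exp_x = vector [0, 1, 0, 2, 1, 0]"
definition conic_exp_y :: "nat ^ 6" where "conic_exp_y = vector [0, 0, 1, 0, 1, 2]"

definition conic_mono :: "complex \<Rightarrow> complex \<Rightarrow> complex ^ 6" where
  "conic_mono x y = (\<chi> j. x ^ conic_exp_x $ j * y ^ conic_exp_y $ j)"

definition conic_matrix :: "complex ^ 6 \<Rightarrow> complex ^ 6 \<Rightarrow> complex ^ 6 ^ 6" where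
  "conic_matrix x y = (\<chi> k. conic_mono (x $ k) (y $ k))"

lemma conic_matrix_mult:
  "(conic_matrix x y *v c) $ k = (\<Sum>j\<in>UNIV. conic_mono (x $ k) (y $ k) $ j * c $ j)"
  by (simp add: conic_matrix_def matrix_vector_mult_def)

lemma det_nonzero_iff_trivial_kernel:
  fixes M :: "complex ^ 'n ^ 'n"
  shows "det M \<noteq> 0 \<longleftrightarrow> (\<forall>c. M *v c = 0 \<longrightarrow> c = 0)"
  unfolding invertible_det_nz[symmetric] invertible_left_inverse matrix_left_invertible_ker ..

text \<open>Each side of the quadrilateral contains three vertices, so a conic through all six would contain
  all four sides.  Here the coefficients of the conic are eliminated explicitly.\<close>

lemma no_conic_through_fibre: "det (conic_matrix fibre_x fibre_y) \<noteq> 0"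
  unfolding det_nonzero_iff_trivial_kernel
proof (intro allI impI)
  fix c assume 0: "conic_matrix fibre_x fibre_y *v c = 0"
  have eqs: "\<forall>k. (conic_matrix fibre_x fibre_y *v c) $ k = 0" using 0 by simp
  note eqs = eqs[unfolded conic_matrix_mult sum_6 conic_mono_def forall_6 conic_exp_x_def
      conic_exp_y_def fibre_x_def fibre_y_def vec_lambda_beta vector_6]
  have e1: "c $ 1 + c $ 3 + c $ 6 = 0" and e2: "9 * c $ 1 + 3 * c $ 3 + c $ 6 = 0"
    and e3: "c $ 1 - c $ 2 + c $ 4 = 0" and e4: "c $ 1 + c $ 2 + c $ 4 = 0"
    and e5: "16 * c $ 1 - 8 * c $ 2 + 8 * c $ 3 + 4 * c $ 4 - 4 * c $ 5 + 4 * c $ 6 = 0"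
    and e6: "4 * c $ 1 + 2 * c $ 2 + 2 * c $ 3 + c $ 4 + c $ 5 + c $ 6 = 0"
    using eqs by (simp_all add: power2_eq_square field_simps)
  have 2: "c $ 2 = 0" using e3 e4 by algebra
  have 5: "c $ 5 = 0" using e5 e6 2 by algebra
  have 1: "c $ 1 = 0" using e1 e2 e4 e6 2 5 by algebra
  have 3: "c $ 3 = 0" using e1 e2 1 by algebra
  have 6: "c $ 6 = 0" using e1 1 3 by algebra
  have 4: "c $ 4 = 0" using e4 1 2 by algebra
  show "c = 0" unfolding vec_eq_iff forall_6 using 1 2 3 4 5 6 by simp
qed

text \<open>The determinant is continuous in the six points.\<close>

lemma no_conic_near_fibre:
  "\<exists>\<epsilon>>0. \<forall>x y. (\<forall>k. dist (x $ k) (fibre_x $ k) < \<epsilon> \<and> dist (y $ k) (fibre_y $ k) < \<epsilon>)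
    \<longrightarrow> det (conic_matrix x y) \<noteq> 0"
proof -
  let ?D = "\<lambda>z. det (conic_matrix (fst z) (snd z))"
  have "continuous_on UNIV ?D"
    unfolding det_def conic_matrix_def conic_mono_def vec_lambda_beta
    by (intro continuous_intros)
  then have "isCont ?D (fibre_x, fibre_y)"
    by (simp add: continuous_on_eq_continuous_at)
  then obtain e where e: "e > 0" "\<And>z. dist (fibre_x, fibre_y) z < e \<Longrightarrow> ?D z \<noteq> 0"
    using continuous_at_avoid[of "(fibre_x, fibre_y)" ?D 0] no_conic_through_fibre by auto
  have "det (conic_matrix x y) \<noteq> 0"
    if "\<And>k. dist (x $ k) (fibre_x $ k) < e / 12" "\<And>k. dist (y $ k) (fibre_y $ k) < e / 12" for x y
  proof -
    have "dist x fibre_x \<le> (\<Sum>k\<in>UNIV. dist (x $ k) (fibre_x $ k))"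
      unfolding dist_vec_def by (rule L2_set_le_sum) simp
    also have "\<dots> < (\<Sum>k\<in>(UNIV :: 6 set). e / 12)" by (rule sum_strict_mono) (use that in auto)
    also have "\<dots> = e / 2" by simp
    finally have x: "dist x fibre_x < e / 2" .
    have "dist y fibre_y \<le> (\<Sum>k\<in>UNIV. dist (y $ k) (fibre_y $ k))"
      unfolding dist_vec_def by (rule L2_set_le_sum) simp
    also have "\<dots> < (\<Sum>k\<in>(UNIV :: 6 set). e / 12)" by (rule sum_strict_mono) (use that in auto)
    also have "\<dots> = e / 2" by simp
    finally have y: "dist y fibre_y < e / 2" .
    have "dist (fibre_x, fibre_y) (x, y) \<le> dist fibre_x x + dist fibre_y y"
      unfolding dist_Pair_Pair by (rule sqrt_sum_squares_le_sum) simp_all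
    then show ?thesis using e(2)[of "(x, y)"] x y by (simp add: dist_commute)
  qed
  then show ?thesis using e(1) by (intro exI[of _ "e / 12"]) auto
qed

text \<open>Over each value near \<open>(1, 0, 0, 0)\<close> the conic with coefficients \<open>c y\<close> passes through six points
  that lie on no conic.\<close>

lemma conic_coeffs_vanish_locally:
  fixes c :: "cvec4 \<Rightarrow> complex ^ 6"
  assumes "\<And>w. w \<in> concyclic_variety \<Longrightarrow>
    (\<Sum>j\<in>UNIV. conic_mono (w $ 4) (w $ 5) $ j * c (hsop_vec w) $ j) = 0"
  shows "\<exists>\<delta>>0. \<forall>y\<in>ball (1, 0, 0, 0) \<delta>. c y = 0"
proof -
  obtain \<epsilon> where \<epsilon>: "\<epsilon> > 0" "\<And>x y. (\<And>k. dist (x $ k) (fibre_x $ k) < \<epsilon>) \<Longrightarrow>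
      (\<And>k. dist (y $ k) (fibre_y $ k) < \<epsilon>) \<Longrightarrow> det (conic_matrix x y) \<noteq> 0"
    using no_conic_near_fibre by blast
  have "\<exists>\<delta>>0. \<forall>y\<in>ball (1, 0, 0, 0) \<delta>. \<exists>w\<in>concyclic_variety. hsop_vec w = y \<and>
      dist (w $ 4) (fibre_x $ k) < \<epsilon> \<and> dist (w $ 5) (fibre_y $ k) < \<epsilon>" for k
    using stable_fibre_points[of k] \<epsilon>(1) unfolding stable_fibre_point_def by blast
  then obtain d where d: "\<And>k. d k > 0" "\<And>k y. y \<in> ball (1, 0, 0, 0) (d k) \<Longrightarrow>
      \<exists>w\<in>concyclic_variety. hsop_vec w = y \<and>
      dist (w $ 4) (fibre_x $ k) < \<epsilon> \<and> dist (w $ 5) (fibre_y $ k) < \<epsilon>"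
    by metis
  define \<delta> where "\<delta> = Min (range d)"
  have "\<delta> > 0" using d(1) by (simp add: \<delta>_def)
  have \<delta>: "\<delta> \<le> d k" for k by (simp add: \<delta>_def)
  have "c y = 0" if y: "y \<in> ball (1, 0, 0, 0) \<delta>" for y
  proof -
    have "\<exists>w\<in>concyclic_variety. hsop_vec w = y \<and>
        dist (w $ 4) (fibre_x $ k) < \<epsilon> \<and> dist (w $ 5) (fibre_y $ k) < \<epsilon>" for k
      by (rule d(2)) (use y \<delta>[of k] in \<open>auto intro: less_le_trans\<close>)
    then obtain w where w: "\<And>k. w k \<in> concyclic_variety" "\<And>k. hsop_vec (w k) = y"
      "\<And>k. dist (w k $ 4) (fibre_x $ k) < \<epsilon>" "\<And>k. dist (w k $ 5) (fibre_y $ k) < \<epsilon>"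
      by metis
    let ?x = "\<chi> k. w k $ 4" and ?y = "\<chi> k. w k $ 5"
    have "det (conic_matrix ?x ?y) \<noteq> 0" by (rule \<epsilon>(2)) (simp_all add: w)
    moreover have "conic_matrix ?x ?y *v c y = 0"
      unfolding vec_eq_iff conic_matrix_mult using assms[OF w(1)] by (simp add: w(2))
    ultimately show ?thesis unfolding det_nonzero_iff_trivial_kernel by blast
  qed
  then show ?thesis using \<open>\<delta> > 0\<close> by blast
qed

lemma poly_coeffs_zero_if_infinite_roots:
  fixes f :: "nat \<Rightarrow> complex"
  assumes "infinite U" "\<And>y. y \<in> U \<Longrightarrow> (\<Sum>a\<le>N. f a * y ^ a) = 0" "a \<le> N"
  shows "f a = 0"
proof (rule ccontr)
  assume "f a \<noteq> 0"
  then have "finite {y. (\<Sum>a\<le>N. f a * y ^ a) = 0}"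
    unfolding polyfun_finite_roots using assms(3) by blast
  moreover have "U \<subseteq> {y. (\<Sum>a\<le>N. f a * y ^ a) = 0}" using assms(2) by auto
  ultimately show False using assms(1) finite_subset by blast
qed

lemma poly4_coeffs_zero:
  fixes v :: "nat \<Rightarrow> nat \<Rightarrow> nat \<Rightarrow> nat \<Rightarrow> complex"
  assumes "\<delta> > 0"
    and zero: "\<And>y1 y2 y3 y4. (y1, y2, y3, y4) \<in> ball (1, 0, 0, 0) \<delta> \<Longrightarrow>
      (\<Sum>a\<le>N. \<Sum>b\<le>N. \<Sum>c\<le>N. \<Sum>d\<le>N. v a b c d * (y1 ^ a * y2 ^ b * y3 ^ c * y4 ^ d)) = 0"
    and le: "a \<le> N" "b \<le> N" "c \<le> N" "d \<le> N"
  shows "v a b c d = 0"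
proof -
  have inf: "infinite (ball z (\<delta> / 4))" for z :: complex
    using \<open>\<delta> > 0\<close> by (intro uncountable_infinite uncountable_ball) simp
  have sq: "sqrt (x\<^sup>2 + y\<^sup>2) \<le> x + y" if "x \<ge> 0" "y \<ge> 0" for x y :: real
    using that by (rule sqrt_sum_squares_le_sum)
  have dist4: "dist (p1, p2, p3, p4) (q1, q2, q3, q4) \<le> dist p1 q1 + (dist p2 q2 + (dist p3 q3 + dist p4 q4))"
    for p1 p2 p3 p4 q1 q2 q3 q4 :: complex
    unfolding dist_Pair_Pair
    by (intro order_trans[OF sq] add_left_mono real_sqrt_ge_zero add_nonneg_nonneg zero_le_power2
        zero_le_dist order_refl sq)
  have n1: "(\<Sum>a\<le>N. (\<Sum>b\<le>N. (\<Sum>c\<le>N. (\<Sum>d\<le>N. v a b c d * y4 ^ d) * y3 ^ c) * y2 ^ b) * y1 ^ a) = 0"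
    if "y1 \<in> ball 1 (\<delta> / 4)" "y2 \<in> ball 0 (\<delta> / 4)" "y3 \<in> ball 0 (\<delta> / 4)" "y4 \<in> ball 0 (\<delta> / 4)"
    for y1 y2 y3 y4
  proof -
    have "(y1, y2, y3, y4) \<in> ball (1, 0, 0, 0) \<delta>"
      using dist4[of 1 0 0 0 y1 y2 y3 y4] that by simp
    from zero[OF this] show ?thesis by (simp add: sum_distrib_left sum_distrib_right mult_ac)
  qed
  have n2: "(\<Sum>b\<le>N. (\<Sum>c\<le>N. (\<Sum>d\<le>N. v a b c d * y4 ^ d) * y3 ^ c) * y2 ^ b) = 0"
    if "y2 \<in> ball 0 (\<delta> / 4)" "y3 \<in> ball 0 (\<delta> / 4)" "y4 \<in> ball 0 (\<delta> / 4)" for y2 y3 y4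
    by (rule poly_coeffs_zero_if_infinite_roots[OF inf[of 1] n1[OF _ that] le(1)])
  have n3: "(\<Sum>c\<le>N. (\<Sum>d\<le>N. v a b c d * y4 ^ d) * y3 ^ c) = 0"
    if "y3 \<in> ball 0 (\<delta> / 4)" "y4 \<in> ball 0 (\<delta> / 4)" for y3 y4
    by (rule poly_coeffs_zero_if_infinite_roots[OF inf[of 0] n2[OF _ that] le(2)])
  have n4: "(\<Sum>d\<le>N. v a b c d * y4 ^ d) = 0" if "y4 \<in> ball 0 (\<delta> / 4)" for y4
    by (rule poly_coeffs_zero_if_infinite_roots[OF inf[of 0] n3[OF _ that] le(3)])
  show ?thesis
    by (rule poly_coeffs_zero_if_infinite_roots[OF inf[of 0] n4 le(4)])
qed

lemma conic_exp_inj: "conic_exp_x $ i = conic_exp_x $ j \<Longrightarrow> conic_exp_y $ i = conic_exp_y $ j \<Longrightarrow> i = j"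
  using exhaust_6[of i] exhaust_6[of j] by (elim disjE) (simp_all add: conic_exp_x_def conic_exp_y_def)

lemma conic_exp_surj:
  assumes "g + h \<le> 2"
  obtains j where "conic_exp_x $ j = g" "conic_exp_y $ j = h"
proof -
  consider "g = 0" "h = 0" | "g = 1" "h = 0" | "g = 0" "h = 1" | "g = 2" "h = 0" | "g = 1" "h = 1"
    | "g = 0" "h = 2" using assms by linarith
  then show ?thesis
  proof cases
    case 1 show ?thesis by (rule that[of 1]) (simp_all add: 1 conic_exp_x_def conic_exp_y_def)
  next
    case 2 show ?thesis by (rule that[of 2]) (simp_all add: 2 conic_exp_x_def conic_exp_y_def)
  next
    case 3 show ?thesis by (rule that[of 3]) (simp_all add: 3 conic_exp_x_def conic_exp_y_def)
  next
    case 4 show ?thesis by (rule that[of 4]) (simp_all add: 4 conic_exp_x_def conic_exp_y_def)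
  next
    case 5 show ?thesis by (rule that[of 5]) (simp_all add: 5 conic_exp_x_def conic_exp_y_def)
  next
    case 6 show ?thesis by (rule that[of 6]) (simp_all add: 6 conic_exp_x_def conic_exp_y_def)
  qed
qed

text \<open>Indexing the degree-two part by the type \<open>6\<close> matches the columns of the conic matrix with the
  standard monomials.\<close>

definition std_exp_of :: "6 \<times> nat \<times> nat \<times> nat \<times> nat \<Rightarrow> std_exp" where
  "std_exp_of = (\<lambda>(j, a, b, c, d). (a, b, c, d, conic_exp_x $ j, conic_exp_y $ j))"

lemma inj_std_exp_of: "inj std_exp_of"
  by (rule injI) (auto simp: std_exp_of_def dest: conic_exp_inj)

lemma std_index_subset_image:
  "std_index t \<subseteq> std_exp_of ` (UNIV \<times> {..t} \<times> {..t} \<times> {..t} \<times> {..t})"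
proof clarify
  fix a b c d g h assume "(a, b, c, d, g, h) \<in> std_index t"
  then have gh: "g + h \<le> 2" and le: "a + b + c + d + g + h \<le> t" by (auto simp: std_index_def)
  obtain j where "conic_exp_x $ j = g" "conic_exp_y $ j = h" using conic_exp_surj[OF gh] .
  then have "(a, b, c, d, g, h) = std_exp_of (j, a, b, c, d)" by (simp add: std_exp_of_def)
  moreover have "(j, a, b, c, d) \<in> UNIV \<times> {..t} \<times> {..t} \<times> {..t} \<times> {..t}" using le by simp
  ultimately show "(a, b, c, d, g, h) \<in> std_exp_of ` (UNIV \<times> {..t} \<times> {..t} \<times> {..t} \<times> {..t})" by blast
qed

lemma finite_std_index: "finite (std_index t)"
  by (rule finite_subset[OF std_index_subset_image]) simp

text \<open>Grouping a relation by the monomials in \<open>X, Y\<close> gives a conic whose coefficients are polynomials in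
  the \<open>h\<^sub>k\<close>.  They vanish on an open set, hence identically.\<close>

lemma std_mono_independent:
  assumes zero: "\<And>w. w \<in> concyclic_variety \<Longrightarrow> (\<Sum>m\<in>std_index t. u m * std_mono m w) = 0"
    and "m \<in> std_index t"
  shows "u m = 0"
proof -
  define v where "v m = (if m \<in> std_index t then u m else 0)" for m
  let ?B = "(UNIV :: 6 set) \<times> {..t} \<times> {..t} \<times> {..t} \<times> {..t}"
  define C :: "cvec4 \<Rightarrow> complex ^ 6" where "C = (\<lambda>(y1, y2, y3, y4). \<chi> j. \<Sum>a\<le>t. \<Sum>b\<le>t. \<Sum>c\<le>t. \<Sum>d\<le>t.
    v (std_exp_of (j, a, b, c, d)) * (y1 ^ a * y2 ^ b * y3 ^ c * y4 ^ d))"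
  have "(\<Sum>j\<in>UNIV. conic_mono (w $ 4) (w $ 5) $ j * C (hsop_vec w) $ j)
      = (\<Sum>m\<in>std_index t. u m * std_mono m w)" for w
  proof -
    have "(\<Sum>m\<in>std_index t. u m * std_mono m w) = (\<Sum>m\<in>std_exp_of ` ?B. v m * std_mono m w)"
      by (rule sum.mono_neutral_cong_left) (use std_index_subset_image in \<open>auto simp: v_def\<close>)
    also have "\<dots> = (\<Sum>x\<in>?B. v (std_exp_of x) * std_mono (std_exp_of x) w)"
      by (subst sum.reindex) (auto intro: inj_on_subset[OF inj_std_exp_of])
    also have "\<dots> = (\<Sum>j\<in>UNIV. \<Sum>a\<le>t. \<Sum>b\<le>t. \<Sum>c\<le>t. \<Sum>d\<le>t.
        v (std_exp_of (j, a, b, c, d)) * std_mono (std_exp_of (j, a, b, c, d)) w)"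
      by (simp only: sum.cartesian_product case_prod_unfold prod.collapse)
    also have "\<dots> = (\<Sum>j\<in>UNIV. conic_mono (w $ 4) (w $ 5) $ j * C (hsop_vec w) $ j)"
      by (simp add: C_def hsop_vec_def conic_mono_def std_exp_of_def std_mono_def
          sum_distrib_left mult_ac)
    finally show ?thesis ..
  qed
  then obtain \<delta> where \<delta>: "\<delta> > 0" "\<And>y. y \<in> ball (1, 0, 0, 0) \<delta> \<Longrightarrow> C y = 0"
    using conic_coeffs_vanish_locally[of C] zero by auto
  obtain j a b c d where m: "m = std_exp_of (j, a, b, c, d)"
    and le: "a \<le> t" "b \<le> t" "c \<le> t" "d \<le> t"
    using std_index_subset_image assms(2) by blast
  have "v (std_exp_of (j, a, b, c, d)) = 0"
  proof (rule poly4_coeffs_zero[OF \<delta>(1) _ le])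
    fix y1 y2 y3 y4 :: complex assume "(y1, y2, y3, y4) \<in> ball (1, 0, 0, 0) \<delta>"
    then have "C (y1, y2, y3, y4) $ j = 0" by (simp only: \<delta>(2) zero_index)
    then show "(\<Sum>a\<le>t. \<Sum>b\<le>t. \<Sum>c\<le>t. \<Sum>d\<le>t. v (std_exp_of (j, a, b, c, d))
        * (y1 ^ a * y2 ^ b * y3 ^ c * y4 ^ d)) = 0"
      by (simp add: C_def)
  qed
  then show ?thesis using assms(2) by (simp add: v_def m)
qed

section \<open>Hilbert polynomial, dimension and degree\<close>

lemma fun_vs_independent_family:
  fixes e :: "'i \<Rightarrow> 'a \<Rightarrow> complex"
  assumes "finite I"
    and indep: "\<And>u i. (\<And>x. (\<Sum>i\<in>I. u i * e i x) = 0) \<Longrightarrow> i \<in> I \<Longrightarrow> u i = 0"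
  shows "inj_on e I" "fun_vs.independent (e ` I)"
proof -
  show inj: "inj_on e I"
  proof (rule inj_onI, rule ccontr)
    fix i j assume ij: "i \<in> I" "j \<in> I" "e i = e j" "i \<noteq> j"
    define u :: "'i \<Rightarrow> complex" where "u k = (if k = i then 1 else if k = j then -1 else 0)" for k
    have "(\<Sum>k\<in>I. u k * e k x) = 0" for x
    proof -
      have "(\<Sum>k\<in>I. u k * e k x) = (\<Sum>k\<in>{i, j}. u k * e k x)"
        by (rule sum.mono_neutral_right) (use \<open>finite I\<close> ij in \<open>auto simp: u_def\<close>)
      then show ?thesis using ij by (simp add: u_def)
    qed
    from indep[OF this ij(1)] show False by (simp add: u_def)
  qed
  show "fun_vs.independent (e ` I)"
  proof (rule fun_vs.independent_if_scalars_zero)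
    show "finite (e ` I)" using \<open>finite I\<close> by simp
    fix u f assume 0: "(\<Sum>f\<in>e ` I. (\<lambda>x. u f * f x)) = 0" and "f \<in> e ` I"
    then obtain i where i: "i \<in> I" "f = e i" by blast
    have "(\<Sum>i\<in>I. u (e i) * e i x) = 0" for x
    proof -
      have "(\<Sum>i\<in>I. u (e i) * e i x) = (\<Sum>f\<in>e ` I. (\<lambda>x. u f * f x)) x"
        by (simp add: fun_sum_apply sum.reindex[OF inj])
      then show ?thesis by (simp add: 0)
    qed
    from indep[OF this i(1)] show "u f = 0" by (simp add: i)
  qed
qed

lemma hilbert_fun_concyclic_variety: "hilbert_fun concyclic_variety t = card (std_index t)"
proof -
  let ?e = "\<lambda>m. restrict_fun concyclic_variety (std_mono m)"
  have indep: "u m = 0" if "\<And>w. (\<Sum>m\<in>std_index t. u m * ?e m w) = 0" "m \<in> std_index t" for u m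
  proof (rule std_mono_independent[OF _ that(2)])
    fix w assume "w \<in> concyclic_variety"
    then show "(\<Sum>m\<in>std_index t. u m * std_mono m w) = 0"
      using that(1)[of w] by (simp add: restrict_fun_def)
  qed
  have fam: "inj_on ?e (std_index t)" "fun_vs.independent (?e ` std_index t)"
    by (rule fun_vs_independent_family[OF finite_std_index]; rule indep; assumption)+
  have "?e ` std_index t \<subseteq> restrict_fun concyclic_variety ` poly_funs_le t"
    using std_mono_poly by blast
  moreover have "restrict_fun concyclic_variety ` poly_funs_le t \<subseteq> fun_vs.span (?e ` std_index t)"
  proof clarify
    fix f :: "complex ^ 6 \<Rightarrow> complex" assume "f \<in> poly_funs_le t"
    then have "f \<in> std_span t" using poly_funs_le_subset_std_span by blast
    then show "restrict_fun concyclic_variety f \<in> fun_vs.span (?e ` std_index t)"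
      unfolding std_span_def vimage_eq image_image .
  qed
  moreover have "fun_vs.independent (?e ` std_index t)" by (rule fam(2))
  moreover have "card (?e ` std_index t) = card (std_index t)" by (rule card_image) (rule fam(1))
  ultimately show ?thesis unfolding hilbert_fun_eq_dim by (rule fun_vs.dim_unique)
qed

definition simplex4 :: "nat \<Rightarrow> (nat \<times> nat \<times> nat \<times> nat) set" where
  "simplex4 n = {(a, b, c, d). a + b + c + d \<le> n}"

lemma sum_rising:
  fixes n :: nat
  shows "2 * (\<Sum>a\<le>n. n - a + 1) = (n + 1) * (n + 2)"
    and "3 * (\<Sum>a\<le>n. (n - a + 1) * (n - a + 2)) = (n + 1) * (n + 2) * (n + 3)"
    and "4 * (\<Sum>a\<le>n. (n - a + 1) * (n - a + 2) * (n - a + 3)) = (n + 1) * (n + 2) * (n + 3) * (n + 4)"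
proof -
  have rev: "(\<Sum>a\<le>n. f (n - a)) = (\<Sum>a\<le>n. f a)" for f :: "nat \<Rightarrow> nat"
    using sum.nat_diff_reindex[of f "Suc n"] by (simp add: lessThan_Suc_atMost)
  show "2 * (\<Sum>a\<le>n. n - a + 1) = (n + 1) * (n + 2)"
    unfolding rev[of "\<lambda>a. a + 1"] by (induction n) (auto simp: algebra_simps)
  show "3 * (\<Sum>a\<le>n. (n - a + 1) * (n - a + 2)) = (n + 1) * (n + 2) * (n + 3)"
    unfolding rev[of "\<lambda>a. (a + 1) * (a + 2)"] by (induction n) (auto simp: algebra_simps)
  show "4 * (\<Sum>a\<le>n. (n - a + 1) * (n - a + 2) * (n - a + 3)) = (n + 1) * (n + 2) * (n + 3) * (n + 4)"
    unfolding rev[of "\<lambda>a. (a + 1) * (a + 2) * (a + 3)"] by (induction n) (auto simp: algebra_simps)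
qed

text \<open>Summation over one exponent at a time gives \<open>n + 4 choose 4\<close>.\<close>

lemma card_simplex4: "24 * card (simplex4 n) = (n + 1) * (n + 2) * (n + 3) * (n + 4)"
proof -
  let ?T2 = "\<lambda>n. SIGMA c:{..n::nat}. {..n - c}"
  let ?T3 = "\<lambda>n. SIGMA b:{..n}. ?T2 (n - b)"
  let ?T4 = "\<lambda>n. SIGMA a:{..n}. ?T3 (n - a)"
  have T2: "2 * card (?T2 n) = (n + 1) * (n + 2)" for n
    using sum_rising(1)[of n] by (simp add: card_SigmaI)
  have T3: "6 * card (?T3 n) = (n + 1) * (n + 2) * (n + 3)" for n
  proof -
    have "6 * card (?T3 n) = 3 * (\<Sum>b\<le>n. 2 * card (?T2 (n - b)))"
      by (subst card_SigmaI) (auto simp: sum_distrib_left)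
    then show ?thesis unfolding T2 sum_rising(2) .
  qed
  have T4: "24 * card (?T4 n) = 4 * (\<Sum>a\<le>n. 6 * card (?T3 (n - a)))"
    by (subst card_SigmaI) (auto simp: sum_distrib_left)
  have "simplex4 n = ?T4 n" by (auto simp: simplex4_def)
  then show ?thesis using T4 unfolding T3 sum_rising(3) by simp
qed

text \<open>One simplex of exponents of the \<open>h\<^sub>k\<close> for each of the monomials \<open>1\<close>; \<open>X, Y\<close>; \<open>X\<^sup>2, X Y, Y\<^sup>2\<close>.  For
  \<open>t < 2\<close> the truncated differences would count nonexistent monomials.\<close>

lemma card_std_index:
  assumes "t \<ge> 2"
  shows "card (std_index t) = card (simplex4 t) + 2 * card (simplex4 (t - 1)) + 3 * card (simplex4 (t - 2))"
proof -
  let ?d = "\<lambda>j. conic_exp_x $ j + conic_exp_y $ j"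
  have d: "?d j \<le> 2" for j
    using exhaust_6[of j] by (auto simp: conic_exp_x_def conic_exp_y_def)
  have "std_index t = std_exp_of ` (SIGMA j:UNIV. simplex4 (t - ?d j))"
  proof (intro equalityI subsetI)
    fix m assume m: "m \<in> std_index t"
    then obtain j a b c d where j: "m = std_exp_of (j, a, b, c, d)"
      using std_index_subset_image by blast
    then have "(j, a, b, c, d) \<in> (SIGMA j:UNIV. simplex4 (t - ?d j))"
      using m by (auto simp: std_exp_of_def std_index_def simplex4_def)
    then show "m \<in> std_exp_of ` (SIGMA j:UNIV. simplex4 (t - ?d j))" unfolding j by (rule imageI)
  next
    fix m assume "m \<in> std_exp_of ` (SIGMA j:UNIV. simplex4 (t - ?d j))"
    then obtain j a b c e where m: "m = std_exp_of (j, a, b, c, e)" "a + b + c + e \<le> t - ?d j"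
      by (auto simp: simplex4_def)
    then show "m \<in> std_index t"
      using d[of j] assms by (simp add: std_exp_of_def std_index_def)
  qed
  then have "card (std_index t) = card (SIGMA j:UNIV. simplex4 (t - ?d j))"
    using card_image[OF inj_on_subset[OF inj_std_exp_of subset_UNIV]] by metis
  also have "\<dots> = (\<Sum>j\<in>UNIV. card (simplex4 (t - ?d j)))"
  proof (rule card_SigmaI)
    have "finite (simplex4 n)" for n
      by (rule finite_subset[of _ "{..n} \<times> {..n} \<times> {..n} \<times> {..n}"]) (auto simp: simplex4_def)
    then show "\<forall>j\<in>UNIV. finite (simplex4 (t - ?d j))" by simp
  qed simp
  also have "\<dots> = card (simplex4 t) + 2 * card (simplex4 (t - 1)) + 3 * card (simplex4 (t - 2))"
    by (simp add: sum_6 conic_exp_x_def conic_exp_y_def numeral_2_eq_2[symmetric])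
  finally show ?thesis .
qed

lemma hilbert_fun_concyclic_poly:
  assumes "t \<ge> 2"
  shows "real (hilbert_fun concyclic_variety t) = poly [:1, 7/3, 9/4, 7/6, 1/4:] (real t)"
proof -
  obtain s where s: "t = s + 2" using assms by (metis add.commute le_Suc_ex)
  have c: "real (card (simplex4 n)) = (real n + 1) * (real n + 2) * (real n + 3) * (real n + 4) / 24" for n
  proof -
    have "real (24 * card (simplex4 n)) = real ((n + 1) * (n + 2) * (n + 3) * (n + 4))"
      unfolding card_simplex4 ..
    then have "24 * real (card (simplex4 n)) = (real n + 1) * (real n + 2) * (real n + 3) * (real n + 4)"
      by (simp only: of_nat_mult of_nat_add of_nat_numeral of_nat_1)
    then show ?thesis by (metis nonzero_mult_div_cancel_left zero_neq_numeral)
  qed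
  show ?thesis
    unfolding hilbert_fun_concyclic_variety card_std_index[OF assms] of_nat_add of_nat_mult c
    by (simp add: s field_simps)
qed

lemma hilbert_poly_eqI:
  assumes "\<And>t. t \<ge> N \<Longrightarrow> real (hilbert_fun V t) = poly p (real t)"
  shows "hilbert_poly V = p"
  unfolding hilbert_poly_def
proof (rule the_equality)
  show "eventually (\<lambda>t. real (hilbert_fun V t) = poly p (real t)) sequentially"
    using assms unfolding eventually_sequentially by blast
  fix q assume "eventually (\<lambda>t. real (hilbert_fun V t) = poly q (real t)) sequentially"
  then obtain M where M: "\<And>t. t \<ge> M \<Longrightarrow> real (hilbert_fun V t) = poly q (real t)"
    unfolding eventually_sequentially by blast
  have "real ` {max M N..} \<subseteq> {x. poly (q - p) x = 0}"
    using M assms by (auto simp: max_def)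
  moreover have "infinite (real ` {max M N..})"
    by (simp add: finite_image_iff infinite_Ici inj_on_def)
  ultimately have "infinite {x. poly (q - p) x = 0}" using finite_subset by blast
  then show "q = p" using poly_roots_finite[of "q - p"] by auto
qed

lemma variety_degree_concyclic: "variety_degree concyclic_variety = 6"
proof -
  have "hilbert_poly concyclic_variety = [:1, 7/3, 9/4, 7/6, 1/4:]"
    by (rule hilbert_poly_eqI[OF hilbert_fun_concyclic_poly])
  then show ?thesis by (simp add: variety_degree_def fact_numeral)
qed

lemma variety_dim_concyclic_le: "variety_dim concyclic_variety \<le> 4"
proof -
  have "hilbert_fun concyclic_variety t \<le> 6 * (t + 1) ^ 4" for t
  proof -
    have "card (std_index t) \<le> card (std_exp_of ` (UNIV \<times> {..t} \<times> {..t} \<times> {..t} \<times> {..t}))"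
      by (rule card_mono[OF _ std_index_subset_image]) simp
    also have "\<dots> \<le> card ((UNIV :: 6 set) \<times> {..t} \<times> {..t} \<times> {..t} \<times> {..t})"
      by (rule card_image_le) simp
    also have "\<dots> = 6 * (t + 1) ^ 4" by (simp add: card_cartesian_product eval_nat_numeral)
    finally show ?thesis by (simp only: hilbert_fun_concyclic_variety)
  qed
  from variety_dim_le[OF this] show ?thesis by (simp add: numeral_eq_enat)
qed

definition coord_subspace :: "'n set \<Rightarrow> (complex ^ 'n::finite) set" where
  "coord_subspace I = {w. \<forall>i\<in>I. w $ i = 0}"

lemma irreducible_coord_subspace: "irreducible_variety (coord_subspace I)"
proof -
  have "irreducible_variety (zariski_closure (coord_subspace I))"
  proof (rule irreducible_zariski_closure)
    show "coord_subspace I \<noteq> {}" by (auto simp: coord_subspace_def intro: exI[of _ 0])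
    fix a b assume ab: "a \<in> coord_subspace I" "b \<in> coord_subspace I"
    let ?\<gamma> = "\<lambda>t. \<chi> i. a $ i + t * (b $ i - a $ i)"
    show "\<exists>\<gamma>. (\<forall>i. \<exists>p. \<forall>t. \<gamma> t $ i = poly p t) \<and> range \<gamma> \<subseteq> coord_subspace I \<and> \<gamma> 0 = a \<and> \<gamma> 1 = b"
    proof (rule exI[of _ ?\<gamma>], intro conjI allI)
      show "\<exists>p. \<forall>t. ?\<gamma> t $ i = poly p t" for i
        unfolding vec_lambda_beta by (intro poly_curve_intros)
      show "range ?\<gamma> \<subseteq> coord_subspace I" using ab by (auto simp: coord_subspace_def)
      show "?\<gamma> 0 = a" "?\<gamma> 1 = b" by (simp_all add: vec_eq_iff)
    qed
  qed
  moreover have "zariski_closure (coord_subspace I) = coord_subspace I"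
  proof
    show "zariski_closure (coord_subspace I) \<subseteq> coord_subspace I"
    proof
      fix w assume w: "w \<in> zariski_closure (coord_subspace I)"
      have "w $ i = 0" if "i \<in> I" for i
        using w that poly_funs_coord[of i] by (auto simp: zariski_closure_def coord_subspace_def)
      then show "w \<in> coord_subspace I" by (simp add: coord_subspace_def)
    qed
  qed (rule zariski_closure_superset)
  ultimately show ?thesis by simp
qed

lemma coord_subspace_strict:
  fixes I J :: "'n::finite set"
  assumes "I \<subset> J"
  shows "coord_subspace J \<subset> coord_subspace I"
proof -
  obtain j where j: "j \<in> J" "j \<notin> I" using assms by blast
  have "axis j (1 :: complex) \<in> coord_subspace I" "axis j (1 :: complex) \<notin> coord_subspace J"
    using j by (auto simp: coord_subspace_def axis_def)
  moreover have "coord_subspace J \<subseteq> (coord_subspace I :: (complex ^ 'n) set)"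
    using assms by (auto simp: coord_subspace_def)
  ultimately show ?thesis by blast
qed

text \<open>At \<open>x = 0\<close> the map \<open>concyclic_dist\<close> takes the values \<open>(0, s z\<^sup>2 y, s y\<^sup>2 z, s y z, 0, 0)\<close>, and these
  exhaust the points of the subspace with \<open>B, C, X\<close> nonzero.  Any other point is on a line through
  the point with \<open>B = C = X = 1\<close>, almost all of which is of that kind.\<close>

lemma coord_subspace_in_concyclic: "coord_subspace {1, 5, 6} \<subseteq> concyclic_variety"
proof
  fix w :: "complex ^ 6" assume "w \<in> coord_subspace {1, 5, 6}"
  then have w: "w $ 1 = 0" "w $ 5 = 0" "w $ 6 = 0" by (simp_all add: coord_subspace_def)
  have gen: "vector [0, b, c, x, 0, 0] \<in> concyclic_variety" if nz: "b \<noteq> 0" "c \<noteq> 0" "x \<noteq> 0" for b c x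
  proof -
    let ?y = "c / x" and ?z = "b / x" and ?s = "x ^ 3 / (b * c)"
    have "concyclic_dist ?s 0 ?y ?z = vector [0, b, c, x, 0, 0]"
      unfolding concyclic_dist_def vec_eq_iff forall_6 vector_6
      using nz by (simp add: field_simps power2_eq_square power3_eq_cube)
    then show ?thesis by (rule subst) (rule concyclic_dist_in_variety)
  qed
  let ?l = "\<lambda>a t. 1 + t * (a - 1) :: complex"
  let ?\<gamma> = "\<lambda>t. vector [0, ?l (w $ 2) t, ?l (w $ 3) t, ?l (w $ 4) t, 0, 0] :: complex ^ 6"
  have fin: "finite {t. ?l a t = 0}" for a
    using poly_roots_finite[of "[:1, a - 1:]"] by simp
  have "?\<gamma> 1 \<in> concyclic_variety"
    unfolding concyclic_variety_def
  proof (rule zariski_closure_curve[where \<gamma> = ?\<gamma>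
        and F = "{t. ?l (w $ 2) t = 0} \<union> {t. ?l (w $ 3) t = 0} \<union> {t. ?l (w $ 4) t = 0}"])
    show "\<exists>p. \<forall>t. ?\<gamma> t $ i = poly p t" for i
    proof -
      have "\<forall>i. \<exists>p. \<forall>t. ?\<gamma> t $ i = poly p t"
        unfolding forall_6 vector_6 by (intro conjI poly_curve_intros)
      then show ?thesis ..
    qed
    show "finite ({t. ?l (w $ 2) t = 0} \<union> {t. ?l (w $ 3) t = 0} \<union> {t. ?l (w $ 4) t = 0})"
      using fin by simp
    show "?\<gamma> t \<in> zariski_closure {concyclic_dist s x y z |s x y z. True}"
      if "t \<notin> {t. ?l (w $ 2) t = 0} \<union> {t. ?l (w $ 3) t = 0} \<union> {t. ?l (w $ 4) t = 0}" for t
      using gen[of "?l (w $ 2) t" "?l (w $ 3) t" "?l (w $ 4) t"] that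
      unfolding concyclic_variety_def by simp
  qed
  moreover have "?\<gamma> 1 = w" by (simp add: vec_eq_iff forall_6 w)
  ultimately show "w \<in> concyclic_variety" by (simp only:)
qed

lemma variety_dim_concyclic: "variety_dim concyclic_variety = 4"
proof (rule antisym[OF variety_dim_concyclic_le])
  define Z :: "nat \<Rightarrow> (complex ^ 6) set" where
    "Z i = [coord_subspace UNIV, coord_subspace {1, 5, 6, 2, 3}, coord_subspace {1, 5, 6, 2},
      coord_subspace {1, 5, 6}, concyclic_variety] ! i" for i
  have sub: "Z i \<subset> Z (Suc i)" if "i < 4" for i
  proof -
    have "4 \<notin> {1, 5, 6, 2, 3 :: 6}" by simp
    then have "coord_subspace UNIV \<subset> coord_subspace {1, 5, 6, 2, 3 :: 6}"
      by (intro coord_subspace_strict) blast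
    moreover have "3 \<notin> {1, 5, 6, 2 :: 6}" by simp
    then have "coord_subspace {1, 5, 6, 2, 3} \<subset> coord_subspace {1, 5, 6, 2 :: 6}"
      by (intro coord_subspace_strict) blast
    moreover have "2 \<notin> {1, 5, 6 :: 6}" by simp
    then have "coord_subspace {1, 5, 6, 2} \<subset> coord_subspace {1, 5, 6 :: 6}"
      by (intro coord_subspace_strict) blast
    moreover have "concyclic_dist 1 2 3 4 \<notin> coord_subspace {1, 5, 6}"
      by (simp add: concyclic_dist_def coord_subspace_def)
    then have "coord_subspace {1, 5, 6} \<subset> concyclic_variety"
      using coord_subspace_in_concyclic concyclic_dist_in_variety by blast
    moreover have "i = 0 \<or> i = 1 \<or> i = 2 \<or> i = 3" using that by linarith
    ultimately show ?thesis unfolding Z_def by (elim disjE) simp_all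
  qed
  have irr: "irreducible_variety (Z i) \<and> Z i \<subseteq> concyclic_variety" if "i \<le> 4" for i
  proof
    have i: "i = 0 \<or> i = 1 \<or> i = 2 \<or> i = 3 \<or> i = 4" using that by linarith
    show "irreducible_variety (Z i)"
      using i irreducible_coord_subspace irreducible_concyclic_variety
      unfolding Z_def by (elim disjE) simp_all
    have "Z i \<subseteq> Z 4" using that
      by (induction rule: inc_induct) (use sub in \<open>auto simp: psubset_eq\<close>)
    then show "Z i \<subseteq> concyclic_variety" by (simp add: Z_def)
  qed
  have "enat 4 \<le> variety_dim concyclic_variety"
    unfolding variety_dim_def by (rule Sup_upper) (use irr sub in blast)
  then show "4 \<le> variety_dim concyclic_variety" by (simp add: numeral_eq_enat)
qed

lemma variety_codim_concyclic: "variety_codim concyclic_variety = 2"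
  unfolding variety_codim_def variety_dim_concyclic by (simp add: numeral_eq_enat)

section \<open>Solutions of the system\<close>

text \<open>Squared distance between the points of parameters \<open>1\<close> and \<open>u\<close> on the circle of squared radius
  \<open>- s\<close>; by homogeneity the points \<open>u\<close> and \<open>v\<close> have squared distance \<open>chord s (u / v)\<close>.\<close>

definition chord :: "complex \<Rightarrow> complex \<Rightarrow> complex" where
  "chord s u = s * (u - 1)\<^sup>2 / u"

lemma chord_inverse: "chord s (1 / u) = chord s u"
  by (cases "u = 0") (simp_all add: chord_def field_simps power2_eq_square)

text \<open>After clearing the denominator this is a quadratic equation in \<open>u\<close> whose roots have product one.\<close>

lemma chord_surj:
  assumes "s \<noteq> 0"
  obtains u where "u \<noteq> 0" "d = chord s u"
proof -
  define b where "b = - (d / s) - 2"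
  define u where "u = (csqrt (b\<^sup>2 - 4) - b) / 2"
  have "2 * u + b = csqrt (b\<^sup>2 - 4)" by (simp add: u_def field_simps)
  then have r: "(2 * u + b)\<^sup>2 = b\<^sup>2 - 4" by simp
  then have u: "u\<^sup>2 + b * u + 1 = 0" by algebra
  then have "u \<noteq> 0" by auto
  moreover have "d * u = s * (u - 1)\<^sup>2"
  proof -
    have "s * (u - 1)\<^sup>2 - d * u = s * (u\<^sup>2 + b * u + 1)"
      using assms by (simp add: b_def field_simps power2_eq_square)
    then show ?thesis using u by simp
  qed
  ultimately show ?thesis using that by (simp add: chord_def field_simps)
qed

text \<open>The circle equation is quadratic in \<open>A\<close> with these two roots, because \<open>y\<close> and \<open>z\<close> are
  determined by \<open>Y\<close> and \<open>Z\<close> up to inversion only.\<close>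

lemma third_chord:
  assumes "s \<noteq> 0" "y \<noteq> 0" "z \<noteq> 0" and [simp]: "Y = chord s y" "Z = chord s z"
    and eq: "- s * (2 * (A * Y + A * Z + Y * Z) - A\<^sup>2 - Y\<^sup>2 - Z\<^sup>2) - A * Y * Z = 0"
  shows "A = chord s (y / z) \<or> A = chord s (y * z)"
proof -
  have "s * ((A - chord s (y / z)) * (A - chord s (y * z)))
      = - s * (2 * (A * Y + A * Z + Y * Z) - A\<^sup>2 - Y\<^sup>2 - Z\<^sup>2) - A * Y * Z"
    using assms(2,3) by (simp add: chord_def field_simps power2_eq_square)
  then show ?thesis using eq \<open>s \<noteq> 0\<close> by simp
qed

text \<open>Replacing \<open>y\<close> by its inverse keeps \<open>Y\<close> and exchanges the two roots.\<close>

lemma third_chord_oriented: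
  assumes "s \<noteq> 0" "x \<noteq> 0" "X = chord s x"
    and eq: "- s * (2 * (C * X + C * Y + X * Y) - C\<^sup>2 - X\<^sup>2 - Y\<^sup>2) - C * X * Y = 0"
  obtains y where "y \<noteq> 0" "Y = chord s y" "C = chord s (x / y)"
proof -
  obtain y where y: "y \<noteq> 0" "Y = chord s y" using chord_surj[OF assms(1)] .
  from third_chord[OF assms(1,2) y(1) assms(3) y(2) eq]
  show ?thesis
  proof
    assume "C = chord s (x / y)"
    then show ?thesis using that y by blast
  next
    assume "C = chord s (x * y)"
    then show ?thesis using that[of "1 / y"] y by (simp add: chord_inverse)
  qed
qed

lemma chords_in_variety:
  assumes nz: "x \<noteq> 0" "y \<noteq> 0" "z \<noteq> 0"
  shows "vector [chord s (y / z), chord s (x / z), chord s (x / y), chord s x, chord s y, chord s z]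
    \<in> concyclic_variety"
proof -
  have "concyclic_dist (s / (x * y * z)) x y z
      = vector [chord s (y / z), chord s (x / z), chord s (x / y), chord s x, chord s y, chord s z]"
    unfolding concyclic_dist_def vec_eq_iff forall_6 vector_6 chord_def
    using nz by (simp add: field_simps power2_eq_square)
  then show ?thesis by (rule subst) (rule concyclic_dist_in_variety)
qed

text \<open>The factors \<open>a, \<dots>, w\<close> stand for the squares in the numerators of the chords.  Keeping them
  abstract while clearing denominators leaves a pure polynomial identity for the next lemma.\<close>

lemma cayley_menger_scaled:
  fixes s :: complex
  assumes "x \<noteq> 0" "y \<noteq> 0" "z \<noteq> 0"
    and "A = s * a / (y * z)" "B = s * b / (x * z)" "C = s * c / (x * y)"
      "X = s * u / x" "Y = s * v / y" "Z = s * w / z"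
  shows "(- 2 * A\<^sup>2 * X - 2 * A * B * C + 2 * A * B * X + 2 * A * B * Y + 2 * A * C * X + 2 * A * C * Z
        - 2 * A * X\<^sup>2 + 2 * A * X * Y + 2 * A * X * Z - 2 * A * Y * Z
        - 2 * B\<^sup>2 * Y + 2 * B * C * Y + 2 * B * C * Z + 2 * B * X * Y - 2 * B * X * Z
        - 2 * B * Y\<^sup>2 + 2 * B * Y * Z - 2 * C\<^sup>2 * Z - 2 * C * X * Y + 2 * C * X * Z
        + 2 * C * Y * Z - 2 * C * Z\<^sup>2) * (x * y * z)\<^sup>2
    = 2 * s ^ 3 * (- a\<^sup>2 * u * x - a * b * c + a * b * u * y + a * b * v * x + a * c * u * z + a * c * w * x
        - a * u\<^sup>2 * y * z + a * u * v * x * z + a * u * w * x * y - a * v * w * x\<^sup>2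
        - b\<^sup>2 * v * y + b * c * v * z + b * c * w * y + b * u * v * y * z - b * u * w * y\<^sup>2
        - b * v\<^sup>2 * x * z + b * v * w * x * y - c\<^sup>2 * w * z - c * u * v * z\<^sup>2 + c * u * w * y * z
        + c * v * w * x * z - c * w\<^sup>2 * x * y)"
  unfolding assms(4-9) using assms(1-3) by (simp add: field_simps power2_eq_square power3_eq_cube)

lemma cayley_menger_poly:
  fixes x y z :: complex
  assumes "a = (y * z - 1)\<^sup>2" "b = (x - z)\<^sup>2" "c = (x - y)\<^sup>2" "u = (x - 1)\<^sup>2" "v = (y - 1)\<^sup>2" "w = (z - 1)\<^sup>2"
  shows "- a\<^sup>2 * u * x - a * b * c + a * b * u * y + a * b * v * x + a * c * u * z + a * c * w * x
        - a * u\<^sup>2 * y * z + a * u * v * x * z + a * u * w * x * y - a * v * w * x\<^sup>2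
        - b\<^sup>2 * v * y + b * c * v * z + b * c * w * y + b * u * v * y * z - b * u * w * y\<^sup>2
        - b * v\<^sup>2 * x * z + b * v * w * x * y - c\<^sup>2 * w * z - c * u * v * z\<^sup>2 + c * u * w * y * z
        + c * v * w * x * z - c * w\<^sup>2 * x * y
    = - ((x + y * z) * ((x + 1) * (y + 1) * (z + 1)) * ((x - 1) * (y - 1) * (z - 1))\<^sup>2)"
  unfolding assms by algebra

lemma theta_scaled:
  fixes s :: complex
  assumes "x \<noteq> 0" "y \<noteq> 0" "z \<noteq> 0"
    and "A = s * a / (y * z)" "B = s * b / (x * z)" "C = s * c / (x * y)"
  shows "theta A B C = s\<^sup>2 * (2 * (a * b * x * y + a * c * x * z + b * c * y * z)
      - (a * x)\<^sup>2 - (b * y)\<^sup>2 - (c * z)\<^sup>2) / (x * y * z)\<^sup>2"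
  unfolding theta_def assms(4-6) using assms(1-3)
  by (simp add: field_simps power2_eq_square)

lemma circumradius_scaled:
  fixes s :: complex
  assumes nz: "x \<noteq> 0" "y \<noteq> 0" "z \<noteq> 0"
    and abc: "A = s * a / (y * z)" "B = s * b / (x * z)" "C = s * c / (x * y)"
    and eq: "2 * (a * b * x * y + a * c * x * z + b * c * y * z)
      - (a * x)\<^sup>2 - (b * y)\<^sup>2 - (c * z)\<^sup>2 = - (a * b * c)"
  shows "- s * theta A B C = A * B * C"
  unfolding theta_scaled[OF nz abc] eq unfolding abc using nz
  by (simp add: field_simps power2_eq_square)

text \<open>Under \<open>x = - (y * z)\<close> the denominators \<open>x\<close> of \<open>X\<close> and \<open>y * z\<close> of \<open>A\<close> differ by a sign, which turns the
  claim into the polynomial identity in the last hypothesis.\<close>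

lemma orthocentre_distance_scaled:
  fixes s :: complex
  assumes nz: "x \<noteq> 0" "y \<noteq> 0" "z \<noteq> 0"
    and abc: "A = s * a / (y * z)" "B = s * b / (x * z)" "C = s * c / (x * y)"
    and X: "X = s * u / x" and "x = - (y * z)"
    and eq: "u * (2 * (a * b * x * y + a * c * x * z + b * c * y * z)
      - (a * x)\<^sup>2 - (b * y)\<^sup>2 - (c * z)\<^sup>2) = - (a * (b * y + c * z - a * x)\<^sup>2)"
  shows "X * theta A B C = A * (B + C - A)\<^sup>2"
proof -
  have d: "B + C - A = s * (b * y + c * z - a * x) / (x * y * z)"
    unfolding abc using nz by (simp add: field_simps)
  have "X * theta A B C = s ^ 3 * (u * (2 * (a * b * x * y + a * c * x * z + b * c * y * z)
      - (a * x)\<^sup>2 - (b * y)\<^sup>2 - (c * z)\<^sup>2)) / (x * (x * y * z)\<^sup>2)"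
    unfolding theta_scaled[OF nz abc] X by (simp add: power2_eq_square power3_eq_cube)
  also have "\<dots> = s ^ 3 * (a * (b * y + c * z - a * x)\<^sup>2) / ((y * z) * (x * y * z)\<^sup>2)"
    unfolding eq using \<open>x = - (y * z)\<close> by simp
  also have "\<dots> = A * (B + C - A)\<^sup>2"
    unfolding d unfolding abc by (simp add: power2_eq_square power3_eq_cube)
  finally show ?thesis .
qed

lemma chord_ratio: "x \<noteq> 0 \<Longrightarrow> y \<noteq> 0 \<Longrightarrow> chord s (x / y) = s * (x - y)\<^sup>2 / (x * y)"
  by (simp add: chord_def field_simps power2_eq_square)

lemma circumradius_chords:
  assumes "x \<noteq> 0" "y \<noteq> 0" "z \<noteq> 0"
  shows "- s * theta (chord s (y / z)) (chord s (x / z)) (chord s (x / y))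
    = chord s (y / z) * chord s (x / z) * chord s (x / y)"
  by (rule circumradius_scaled[OF assms chord_ratio chord_ratio chord_ratio]) (fact assms | algebra)+

text \<open>The condition \<open>p * q * r = -1\<close> is the symmetric form of \<open>x = - (y * z)\<close>, with \<open>p = 1 / x\<close>.  The
  remaining two vertices follow by exchanging the roles of \<open>p, q, r\<close>.\<close>

lemma orthocentric_chord:
  assumes "p * q * r = -1" and A: "A = chord s (- p)" and B: "B = chord s (- q)" and C: "C = chord s (- r)"
  shows "- s * theta A B C = A * B * C"
    and "chord s p * theta A B C = A * (B + C - A)\<^sup>2"
proof -
  define x where "x = - (q * r)"
  have nz: "x \<noteq> 0" "q \<noteq> 0" "r \<noteq> 0" using assms(1) by (auto simp: x_def)
  have "p * x = 1" "- p * (q * r) = 1" using assms(1) by (simp_all add: x_def mult.assoc)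
  then have p: "p = 1 / x" "- p = 1 / (q * r)" using nz by (simp_all add: eq_divide_eq)
  have q: "- q = x / r" and r: "- r = x / q" using nz by (simp_all add: x_def)
  have A': "A = s * (q * r - 1)\<^sup>2 / (q * r)" unfolding A p(2) chord_inverse by (simp add: chord_def)
  have B': "B = s * (x - r)\<^sup>2 / (x * r)" unfolding B q by (rule chord_ratio) fact+
  have C': "C = s * (x - q)\<^sup>2 / (x * q)" unfolding C r by (rule chord_ratio) fact+
  show "- s * theta A B C = A * B * C"
    by (rule circumradius_scaled[OF nz A' B' C']) (unfold x_def, algebra)
  have X: "chord s p = s * (x - 1)\<^sup>2 / x" unfolding p(1) chord_inverse by (rule chord_def)
  show "chord s p * theta A B C = A * (B + C - A)\<^sup>2"
    by (rule orthocentre_distance_scaled[OF nz A' B' C' X x_def]) (unfold x_def, algebra)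
qed

lemma theta_commute: "theta A B C = theta B A C" "theta A B C = theta C A B"
  by (simp_all add: theta_def algebra_simps)

lemma cayley_menger_chords:
  assumes nz: "x \<noteq> 0" "y \<noteq> 0" "z \<noteq> 0" "s \<noteq> 0"
    and "A = chord s (y * z)" "B = chord s (x / z)" "C = chord s (x / y)"
      "X = chord s x" "Y = chord s y" "Z = chord s z"
    and "- 2 * A\<^sup>2 * X - 2 * A * B * C + 2 * A * B * X + 2 * A * B * Y + 2 * A * C * X + 2 * A * C * Z
        - 2 * A * X\<^sup>2 + 2 * A * X * Y + 2 * A * X * Z - 2 * A * Y * Z
        - 2 * B\<^sup>2 * Y + 2 * B * C * Y + 2 * B * C * Z + 2 * B * X * Y - 2 * B * X * Z
        - 2 * B * Y\<^sup>2 + 2 * B * Y * Z - 2 * C\<^sup>2 * Z - 2 * C * X * Y + 2 * C * X * Z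
        + 2 * C * Y * Z - 2 * C * Z\<^sup>2 = 0"
  shows "x = - (y * z) \<or> x\<^sup>2 = 1 \<or> y\<^sup>2 = 1 \<or> z\<^sup>2 = 1"
proof -
  have A: "A = s * (y * z - 1)\<^sup>2 / (y * z)" using assms(5) by (simp add: chord_def)
  have B: "B = s * (x - z)\<^sup>2 / (x * z)" unfolding assms(6) by (rule chord_ratio) fact+
  have C: "C = s * (x - y)\<^sup>2 / (x * y)" unfolding assms(7) by (rule chord_ratio) fact+
  have XYZ: "X = s * (x - 1)\<^sup>2 / x" "Y = s * (y - 1)\<^sup>2 / y" "Z = s * (z - 1)\<^sup>2 / z"
    using assms(8-10) by (simp_all add: chord_def)
  have "(x + y * z) * ((x + 1) * (y + 1) * (z + 1)) * ((x - 1) * (y - 1) * (z - 1))\<^sup>2 = 0"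
    using cayley_menger_scaled[OF nz(1-3) A B C XYZ] assms(11) \<open>s \<noteq> 0\<close>
    unfolding cayley_menger_poly[OF refl refl refl refl refl refl] by simp
  then have "x + y * z = 0 \<or> x = 1 \<or> x = -1 \<or> y = 1 \<or> y = -1 \<or> z = 1 \<or> z = -1"
    by (auto simp: eq_neg_iff_add_eq_0)
  then show ?thesis unfolding power2_eq_1_iff by (auto simp: eq_neg_iff_add_eq_0)
qed

text \<open>A self-inverse parameter does not distinguish the quotient from the product, so the orientation
  of its point is free.\<close>

lemma chord_square_one: "u\<^sup>2 = 1 \<Longrightarrow> v \<noteq> 0 \<Longrightarrow> chord s (u * v) = chord s (u / v)"
proof -
  assume u: "u\<^sup>2 = 1" and "v \<noteq> 0"
  then have "u \<noteq> 0" by auto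
  then have "u / v = 1 / (u * v)"
    using u \<open>v \<noteq> 0\<close> by (simp add: frac_eq_eq power2_eq_square mult.assoc[symmetric])
  then show ?thesis by (simp only: chord_inverse)
qed

text \<open>Cleared of the denominator \<open>theta\<close>, the alternative holds for every solution with \<open>\<rho> \<noteq> 0\<close>.\<close>

lemma solution_cases:
  assumes "\<rho> \<noteq> 0"
    and cm: "- 2 * A\<^sup>2 * X - 2 * A * B * C + 2 * A * B * X + 2 * A * B * Y + 2 * A * C * X + 2 * A * C * Z
        - 2 * A * X\<^sup>2 + 2 * A * X * Y + 2 * A * X * Z - 2 * A * Y * Z
        - 2 * B\<^sup>2 * Y + 2 * B * C * Y + 2 * B * C * Z + 2 * B * X * Y - 2 * B * X * Z
        - 2 * B * Y\<^sup>2 + 2 * B * Y * Z - 2 * C\<^sup>2 * Z - 2 * C * X * Y + 2 * C * X * Z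
        + 2 * C * Y * Z - 2 * C * Z\<^sup>2 = 0"
    and a: "\<rho> * (2 * (A * Y + A * Z + Y * Z) - A\<^sup>2 - Y\<^sup>2 - Z\<^sup>2) - A * Y * Z = 0"
    and b: "\<rho> * (2 * (B * X + B * Z + X * Z) - X\<^sup>2 - B\<^sup>2 - Z\<^sup>2) - B * X * Z = 0"
    and c: "\<rho> * (2 * (C * X + C * Y + X * Y) - X\<^sup>2 - Y\<^sup>2 - C\<^sup>2) - C * X * Y = 0"
  shows "\<rho> * theta A B C = A * B * C \<and>
    (vector [A, B, C, X, Y, Z] \<in> concyclic_variety \<or>
     X * theta A B C = A * (B + C - A)\<^sup>2 \<and>
     Y * theta A B C = B * (A + C - B)\<^sup>2 \<and>
     Z * theta A B C = C * (A + B - C)\<^sup>2)"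
proof -
  define s where "s = - \<rho>"
  have s: "s \<noteq> 0" "\<rho> = - s" using assms(1) by (simp_all add: s_def)
  obtain x where x: "x \<noteq> 0" "X = chord s x" using chord_surj[OF s(1)] .
  obtain y where y: "y \<noteq> 0" "Y = chord s y" "C = chord s (x / y)"
    by (rule third_chord_oriented[OF s(1) x, of C Y]) (use c s(2) in \<open>simp_all add: algebra_simps\<close>)
  obtain z where z: "z \<noteq> 0" "Z = chord s z" "B = chord s (x / z)"
    by (rule third_chord_oriented[OF s(1) x, of B Z]) (use b s(2) in \<open>simp_all add: algebra_simps\<close>)
  have concyclic: ?thesis if "u \<noteq> 0" "v \<noteq> 0" "w \<noteq> 0" "X = chord s u" "Y = chord s v" "Z = chord s w"
    "A = chord s (v / w)" "B = chord s (u / w)" "C = chord s (u / v)" for u v w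
    using chords_in_variety[OF that(1-3), of s] circumradius_chords[OF that(1-3), of s]
    unfolding that(4-9) s(2) by blast
  have "A = chord s (y / z) \<or> A = chord s (y * z)"
    by (rule third_chord[OF s(1) y(1) z(1) y(2) z(2)]) (use a s(2) in simp)
  then consider "A = chord s (y / z)" | "A = chord s (y * z)" "y\<^sup>2 = 1 \<or> z\<^sup>2 = 1"
    | "A = chord s (y * z)" "x\<^sup>2 = 1" | "A = chord s (y * z)" "x = - (y * z)"
    using cayley_menger_chords[OF x(1) y(1) z(1) s(1) _ z(3) y(3) x(2) y(2) z(2) cm] by blast
  then show ?thesis
  proof cases
    case 1
    show ?thesis by (rule concyclic[OF x(1) y(1) z(1) x(2) y(2) z(2) 1 z(3) y(3)])
  next
    case 2
    (* The side A is also a quotient, so the four parameters are already consistent. *)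
    have "chord s (y * z) = chord s (y / z)"
    proof (cases "y\<^sup>2 = 1")
      case True
      then show ?thesis using z(1) by (rule chord_square_one)
    next
      case False
      then have "chord s (z * y) = chord s (z / y)" using 2(2) y(1) by (intro chord_square_one) auto
      also have "\<dots> = chord s (1 / (y / z))" by simp
      finally show ?thesis by (simp only: chord_inverse mult.commute)
    qed
    then show ?thesis using 2(1)
      by (intro concyclic[OF x(1) y(1) z(1) x(2) y(2) z(2) _ z(3) y(3)]) simp
  next
    case 3
    (* Inverting y turns A into a quotient, and C stays one because x is self-inverse. *)
    have "A = chord s (1 / (y * z))" unfolding chord_inverse by (rule 3(1))
    moreover have "C = chord s (x * y)" using chord_square_one[OF 3(2) y(1)] y(3) by simp
    ultimately show ?thesis
      by (intro concyclic[of x "1 / y" z]) (use x y z in \<open>simp_all add: chord_inverse\<close>)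
  next
    case 4
    have "1 / x * y * z = -1" using 4(2) y(1) z(1) by simp
    have A: "A = chord s (- (1 / x))"
    proof -
      have "- (1 / x) = 1 / (y * z)" using 4(2) by simp
      then show ?thesis using 4(1) by (simp only: chord_inverse)
    qed
    have B: "B = chord s (- y)" and C: "C = chord s (- z)"
      using y z 4(2) by simp_all
    have X: "X = chord s (1 / x)" unfolding chord_inverse by (rule x(2))
    have p: "1 / x * y * z = -1" "y * (1 / x) * z = -1" "z * (1 / x) * y = -1"
      using 4(2) y(1) z(1) by simp_all
    have "Y * theta A B C = B * (A + C - B)\<^sup>2" "Z * theta A B C = C * (A + B - C)\<^sup>2"
      using orthocentric_chord(2)[OF p(2) B A C] orthocentric_chord(2)[OF p(3) C A B]
      unfolding y(2)[symmetric] z(2)[symmetric] theta_commute(1)[of B] theta_commute(2)[of A B C] by simp_all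
    then show ?thesis
      using orthocentric_chord[OF p(1) A B C] unfolding X[symmetric] s(2) by blast
  qed
qed

theorem theorem3:
  shows "\<exists>W :: (complex ^ 6) set.
    irreducible_variety W \<and> variety_codim W = 2 \<and> variety_degree W = 6 \<and>
    (\<forall>A B C X Y Z \<rho> :: complex.
      - 2 * A\<^sup>2 * X - 2 * A * B * C + 2 * A * B * X + 2 * A * B * Y + 2 * A * C * X + 2 * A * C * Z
        - 2 * A * X\<^sup>2 + 2 * A * X * Y + 2 * A * X * Z - 2 * A * Y * Z
        - 2 * B\<^sup>2 * Y + 2 * B * C * Y + 2 * B * C * Z + 2 * B * X * Y - 2 * B * X * Z
        - 2 * B * Y\<^sup>2 + 2 * B * Y * Z - 2 * C\<^sup>2 * Z - 2 * C * X * Y + 2 * C * X * Z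
        + 2 * C * Y * Z - 2 * C * Z\<^sup>2 = 0 \<and>
      \<rho> * (2 * (A * Y + A * Z + Y * Z) - A\<^sup>2 - Y\<^sup>2 - Z\<^sup>2) - A * Y * Z = 0 \<and>
      \<rho> * (2 * (B * X + B * Z + X * Z) - X\<^sup>2 - B\<^sup>2 - Z\<^sup>2) - B * X * Z = 0 \<and>
      \<rho> * (2 * (C * X + C * Y + X * Y) - X\<^sup>2 - Y\<^sup>2 - C\<^sup>2) - C * X * Y = 0
      \<longrightarrow>
      (\<rho> = A * B * C / theta A B C \<and>
        (X, Y, Z) = (A * (B + C - A)\<^sup>2 / theta A B C,
                     B * (A + C - B)\<^sup>2 / theta A B C,
                     C * (A + B - C)\<^sup>2 / theta A B C)) \<or>
      (\<rho> = A * B * C / theta A B C \<and> vector [A, B, C, X, Y, Z] \<in> W) \<or>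
      (\<rho> = 0 \<or> A = 0 \<or> B = 0 \<or> C = 0 \<or> theta A B C = 0))"
proof (rule exI[of _ concyclic_variety], intro conjI allI impI, goal_cases)
  case (4 A B C X Y Z \<rho>)
  then show ?case
  proof (cases "\<rho> = 0 \<or> theta A B C = 0")
    case False
    then have "\<rho> * theta A B C = A * B * C \<and>
      (vector [A, B, C, X, Y, Z] \<in> concyclic_variety \<or>
       X * theta A B C = A * (B + C - A)\<^sup>2 \<and>
       Y * theta A B C = B * (A + C - B)\<^sup>2 \<and>
       Z * theta A B C = C * (A + B - C)\<^sup>2)"
      using 4 by (intro solution_cases) simp_all
    then show ?thesis using False by (auto simp: eq_divide_eq)
  qed blast
qed (rule irreducible_concyclic_variety variety_codim_concyclic variety_degree_concyclic)+

end
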